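(* Let $d,k\ge 1$ and let $\mathbf{P}=(P_1,\dots,P_k)$ be a collection of lattice polytopes in $\mathbb{R}^d$ such that $P_1+\cdots+P_k$ has dimension $d$. Let $\mathrm{ME}_{\mathbf{P}}(n)=\sum_{i=0}^d \mathrm{me}_i(\mathbf{P})\,n^i$ be the mixed Ehrhart polynomial of $\mathbf{P}$ and let $E_{\mathbf{P}}(n_1,\dots,n_k)=\sum_{\alpha\in\mathbb{Z}_{\ge 0}^k} e_\alpha(\mathbf{P})\, n_1^{\alpha_1}\cdots n_k^{\alpha_k}$ be the multivariate Ehrhart polynomial of $\mathbf{P}$. Then for every $0\le i\le d$ $$\mathrm{me}_i(\mathbf{P})=\sum_{\alpha} e_\alpha(\mathbf{P}),$$ where the sum runs over all $\alpha\in\mathbb{Z}_{\ge 1}^k$ (all entries at least $1$) with $|\alpha|:=\alpha_1+\cdots+\alpha_k=i$. In particular, $\mathrm{me}_i(\mathbf{P})=0$ for all $0\le i<k$.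
   Context: A lattice polytope in $\mathbb{R}^d$ is the convex hull of a nonempty finite subset of $\mathbb{Z}^d$. For $J\subseteq[k]=\{1,\dots,k\}$ put $P_J:=\sum_{j\in J}P_j$ (Minkowski sum), with $P_\emptyset=\{0\}$. For a lattice polytope $P$, $E_P(n)$ is its Ehrhart polynomial, i.e. the polynomial with $E_P(n)=|nP\cap\mathbb{Z}^d|$ for all integers $n\ge 0$. The mixed Ehrhart polynomial of $\mathbf{P}$ is $$\mathrm{ME}_{\mathbf{P}}(n):=\sum_{J\subseteq[k]}(-1)^{k-|J|}E_{P_J}(n)\in\mathbb{Q}[n],$$ a polynomial of degree at most $d$; the coefficient of $n^i$ is denoted $\mathrm{me}_i(\mathbf{P})$. By a theorem of Bernstein and McMullen, the function $(n_1,\dots,n_k)\mapsto |(n_1P_1+\cdots+n_kP_k)\cap\mathbb{Z}^d|$ on $\mathbb{Z}_{\ge 0}^k$ agrees with a (unique) polynomial of total degree at most $d$, denoted $E_{\mathbf{P}}(n_1,\dots,n_k)$; its coefficients are denoted $e_\alpha(\mathbf{P})$. *)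

theory Defs
  imports "HOL-Analysis.Analysis" "HOL-Library.Set_Algebras" "HOL-Library.Poly_Mapping"
    "HOL-Computational_Algebra.Polynomial"
begin

text \<open>
  Dimensions and index sets are types: the ambient space is \<open>real ^ 'd\<close> with \<open>d = CARD('d)\<close>, and a
  collection \<open>P\<^sub>1, \<dots>, P\<^sub>k\<close> is a family \<open>P :: 'k \<Rightarrow> (real ^ 'd) set\<close> with \<open>k = CARD('k)\<close>. Both
  numbers are at least 1 because types are inhabited. Sums of sets are the Minkowski sums of
  \<^theory>\<open>HOL-Library.Set_Algebras\<close>; there \<open>0 = {0}\<close>, so the empty sum is \<open>{0}\<close>.
\<close>

definition integer_points :: "(real ^ 'd) set" where
  "integer_points = {x. \<forall>i. x $ i \<in> \<int>}"

definition lattice_polytope :: "(real ^ 'd) set \<Rightarrow> bool" where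
  "lattice_polytope P \<longleftrightarrow>
     (\<exists>V. finite V \<and> V \<noteq> {} \<and> V \<subseteq> integer_points \<and> P = convex hull V)"

definition dilate :: "nat \<Rightarrow> (real ^ 'd) set \<Rightarrow> (real ^ 'd) set" where
  "dilate n P = (\<lambda>x. real n *\<^sub>R x) ` P"

definition ehrhart_poly :: "(real ^ 'd) set \<Rightarrow> rat poly" where
  "ehrhart_poly P =
     (THE p. \<forall>n::nat. poly p (of_nat n) = of_nat (card (dilate n P \<inter> integer_points)))"

definition mixed_ehrhart_poly :: "('k::finite \<Rightarrow> (real ^ 'd) set) \<Rightarrow> rat poly" where
  "mixed_ehrhart_poly P =
     (\<Sum>J\<in>Pow UNIV. smult ((- 1) ^ (CARD('k) - card J)) (ehrhart_poly (\<Sum>j\<in>J. P j)))"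

text \<open>
  A polynomial in variables indexed by \<open>'k\<close> is the finitely supported map sending an exponent
  vector \<open>\<alpha> :: 'k \<Rightarrow> nat\<close> to its coefficient. In both definite descriptions, values at all
  nonnegative integer points determine the polynomial, so the bound \<open>d\<close> on its degree is a property
  rather than part of the definition; existence is the theorem of Ehrhart, respectively of
  Bernstein and McMullen.
\<close>

definition multi_eval :: "(('k::finite \<Rightarrow> nat) \<Rightarrow>\<^sub>0 rat) \<Rightarrow> ('k \<Rightarrow> rat) \<Rightarrow> rat" where
  "multi_eval p x = (\<Sum>\<alpha>\<in>Poly_Mapping.keys p. Poly_Mapping.lookup p \<alpha> * (\<Prod>j\<in>UNIV. x j ^ \<alpha> j))"

definition multi_ehrhart_poly ::
    "('k::finite \<Rightarrow> (real ^ 'd) set) \<Rightarrow> (('k \<Rightarrow> nat) \<Rightarrow>\<^sub>0 rat)" where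
  "multi_ehrhart_poly P =
     (THE p. \<forall>n :: 'k \<Rightarrow> nat. multi_eval p (\<lambda>j. of_nat (n j)) =
        of_nat (card ((\<Sum>j\<in>UNIV. dilate (n j) (P j)) \<inter> integer_points)))"

end

theory Submission
  imports Defs "HOL-Library.Multiset"
begin

text \<open>
  Polynomiality of \<open>n \<mapsto> |(n\<^sub>1 P\<^sub>1 + \<dots> + n\<^sub>k P\<^sub>k) \<inter> \<int>\<^sup>d|\<close>: by the Cayley trick these are the lattice points at
  height \<open>n\<close> of the cone generated by the vectors \<open>(e\<^sub>j, v)\<close> with \<open>v\<close> a vertex of \<open>P\<^sub>j\<close>. Triangulate
  this cone and push it slightly in the direction of a generic interior point \<open>q\<close>: it becomes a
  disjoint union of full-dimensional half-open simplicial cones. In such a cone each lattice point is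
  uniquely a point of a half-open unit box plus a nonnegative integer combination of the generators,
  so the count is a sum of products of binomial coefficients. They are polynomials valid down to
  \<open>n\<^sub>j = 0\<close> because \<open>q\<close> has positive height in every direction.

  Evaluating the multivariate polynomial at \<open>n\<close> times the indicator of \<open>J\<close> gives the Ehrhart polynomial of
  \<open>P\<^sub>J\<close>; only monomials supported in \<open>J\<close> survive, and in the alternating sum over \<open>J\<close> only those of
  full support.
\<close>

section \<open>Half-open triangulations of polyhedral cones\<close>

lemma convex_cone_hull_finite:
  fixes S :: "'a::real_vector set"
  assumes "finite S"
  shows "convex_cone hull S = {\<Sum>w\<in>S. c w *\<^sub>R w | c. \<forall>w\<in>S. 0 \<le> c w}" (is "_ = ?R")
proof
  show "?R \<subseteq> convex_cone hull S"
  proof clarify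
    fix c :: "'a \<Rightarrow> real"
    assume c: "\<forall>w\<in>S. 0 \<le> c w"
    have "T \<subseteq> S \<Longrightarrow> (\<Sum>w\<in>T. c w *\<^sub>R w) \<in> convex_cone hull S" for T
    proof (induction T rule: infinite_finite_induct)
      case (insert w T)
      then show ?case
        using c by (auto intro!: convex_cone_hull_add convex_cone_hull_mul intro: hull_inc)
    qed (auto simp: convex_cone_hull_contains_0)
    then show "(\<Sum>w\<in>S. c w *\<^sub>R w) \<in> convex_cone hull S" by blast
  qed
  show "convex_cone hull S \<subseteq> ?R"
  proof (rule hull_minimal)
    show "S \<subseteq> ?R"
    proof
      fix v assume "v \<in> S"
      then show "v \<in> ?R" using assms
        by (intro CollectI exI[of _ "\<lambda>w. if w = v then 1 else 0"])
          (simp add: if_distrib[of "\<lambda>a. a *\<^sub>R _"] cong: if_cong)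
    qed
    show "convex_cone ?R"
      unfolding convex_cone_iff
    proof (intro conjI ballI allI impI)
      show "0 \<in> ?R" by (intro CollectI exI[of _ "\<lambda>_. 0"]) simp
    next
      fix x y assume "x \<in> ?R" "y \<in> ?R"
      then obtain a b where "x = (\<Sum>w\<in>S. a w *\<^sub>R w)" "\<forall>w\<in>S. 0 \<le> a w"
        "y = (\<Sum>w\<in>S. b w *\<^sub>R w)" "\<forall>w\<in>S. 0 \<le> b w" by blast
      then show "x + y \<in> ?R"
        by (intro CollectI exI[of _ "\<lambda>w. a w + b w"])
          (simp add: scaleR_left_distrib sum.distrib)
    next
      fix x and t :: real assume "x \<in> ?R" "0 \<le> t"
      then obtain a where "x = (\<Sum>w\<in>S. a w *\<^sub>R w)" "\<forall>w\<in>S. 0 \<le> a w" by blast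
      with \<open>0 \<le> t\<close> show "t *\<^sub>R x \<in> ?R"
        by (intro CollectI exI[of _ "\<lambda>w. t * a w"]) (simp add: scaleR_sum_right)
    qed
  qed
qed

lemma convex_cone_hull_insert:
  "convex_cone hull (insert w S) = {t *\<^sub>R w + y | t y. 0 \<le> t \<and> y \<in> convex_cone hull S}"
proof -
  have "convex_cone hull {w} = (\<lambda>t. t *\<^sub>R w) ` {0..}"
    using convex_cone_hull_finite[of "{w}"] by auto
  then show ?thesis
    using convex_cone_hull_Un[of "{w}" S] by auto
qed

lemma in_cone_support:
  fixes S :: "'a::real_vector set"
  assumes "finite S" "\<And>w. w \<in> S \<Longrightarrow> 0 \<le> c w" "{w\<in>S. c w \<noteq> 0} \<subseteq> T"
  shows "(\<Sum>w\<in>S. c w *\<^sub>R w) \<in> convex_cone hull T"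
proof -
  have "(\<Sum>w\<in>S. c w *\<^sub>R w) = (\<Sum>w\<in>{w\<in>S. c w \<noteq> 0}. c w *\<^sub>R w)"
    using assms(1) by (intro sum.mono_neutral_right) auto
  also have "\<dots> \<in> convex_cone hull {w\<in>S. c w \<noteq> 0}"
    using assms(1,2) by (subst convex_cone_hull_finite) auto
  also have "\<dots> \<subseteq> convex_cone hull T" by (rule hull_mono[OF assms(3)])
  finally show ?thesis .
qed

text \<open>Split each coefficient into its positive and negative parts.\<close>

lemma span_eq_cone_diff:
  fixes S :: "'a::real_vector set"
  assumes "finite S" "x \<in> span S"
  obtains u v where "u \<in> convex_cone hull S" "v \<in> convex_cone hull S" "x = u - v"
proof -
  obtain c where c: "x = (\<Sum>w\<in>S. c w *\<^sub>R w)"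
    using assms span_finite by auto
  have "x = (\<Sum>w\<in>S. max 0 (c w) *\<^sub>R w) - (\<Sum>w\<in>S. max 0 (- c w) *\<^sub>R w)"
    unfolding c sum_subtractf[symmetric] by (intro sum.cong) (auto simp: max_def)
  then show thesis
    by (rule that[rotated 2]) (use assms(1) in \<open>auto intro!: in_cone_support\<close>)
qed

text \<open>Each of the finitely many terms tends to \<open>a v > 0\<close> as \<open>e\<close>
  tends to 0 from the right. The filter form lets several conditions on small \<open>e\<close> be
  imposed at once.\<close>

lemma eventually_small_perturbation:
  fixes a b :: "'a \<Rightarrow> real"
  assumes "finite S" "\<And>v. v \<in> S \<Longrightarrow> 0 < a v"
  shows "\<forall>\<^sub>F e in at_right 0. \<forall>v\<in>S. 0 < a v + e * b v"
proof (intro eventually_ball_finite assms ballI)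
  fix v assume "v \<in> S"
  have "((\<lambda>e. a v + e * b v) \<longlongrightarrow> a v + 0 * b v) (at_right 0)" by (intro tendsto_intros)
  then show "\<forall>\<^sub>F e in at_right 0. 0 < a v + e * b v"
    using assms(2)[OF \<open>v \<in> S\<close>] by (intro order_tendstoD(1)) auto
qed

text \<open>
  A triangulation of the cone over \<open>W\<close>, given by its cells; that distinct cells meet only in common
  faces is expressed by the uniqueness of a nonnegative combination supported in a cell.
\<close>

lemma placing_triangulation:
  fixes W :: "'a::euclidean_space set"
  assumes "finite W"
  shows "\<exists>\<Delta>. \<Delta> \<subseteq> Pow W \<and> (\<forall>\<sigma>\<in>\<Delta>. independent \<sigma>)
      \<and> convex_cone hull W \<subseteq> (\<Union>\<sigma>\<in>\<Delta>. convex_cone hull \<sigma>)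
      \<and> (\<forall>c c'. (\<forall>w\<in>W. 0 \<le> c w \<and> 0 \<le> c' w)
           \<longrightarrow> (\<exists>\<sigma>\<in>\<Delta>. {w\<in>W. c w \<noteq> 0} \<subseteq> \<sigma>) \<longrightarrow> (\<exists>\<sigma>\<in>\<Delta>. {w\<in>W. c' w \<noteq> 0} \<subseteq> \<sigma>)
           \<longrightarrow> (\<Sum>w\<in>W. c w *\<^sub>R w) = (\<Sum>w\<in>W. c' w *\<^sub>R w) \<longrightarrow> (\<forall>w\<in>W. c w = c' w))"
  using assms
proof (induction W)
  case empty
  then show ?case by (intro exI[of _ "{{}}"]) (auto simp: independent_empty)
next
  case (insert w W)
  then obtain \<Delta> where sub: "\<Delta> \<subseteq> Pow W" and ind: "\<And>\<sigma>. \<sigma> \<in> \<Delta> \<Longrightarrow> independent \<sigma>"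
    and cov: "convex_cone hull W \<subseteq> (\<Union>\<sigma>\<in>\<Delta>. convex_cone hull \<sigma>)"
    and "\<forall>c c'. (\<forall>w\<in>W. 0 \<le> c w \<and> 0 \<le> c' w)
           \<longrightarrow> (\<exists>\<sigma>\<in>\<Delta>. {w\<in>W. c w \<noteq> 0} \<subseteq> \<sigma>) \<longrightarrow> (\<exists>\<sigma>\<in>\<Delta>. {w\<in>W. c' w \<noteq> 0} \<subseteq> \<sigma>)
           \<longrightarrow> (\<Sum>w\<in>W. c w *\<^sub>R w) = (\<Sum>w\<in>W. c' w *\<^sub>R w) \<longrightarrow> (\<forall>w\<in>W. c w = c' w)"
    by (elim exE conjE) blast
  then have uniq: "\<forall>w\<in>W. c w = c' w"
    if "\<And>w. w \<in> W \<Longrightarrow> 0 \<le> c w" "\<And>w. w \<in> W \<Longrightarrow> 0 \<le> c' w"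
      "\<exists>\<sigma>\<in>\<Delta>. {w\<in>W. c w \<noteq> 0} \<subseteq> \<sigma>" "\<exists>\<sigma>\<in>\<Delta>. {w\<in>W. c' w \<noteq> 0} \<subseteq> \<sigma>"
      "(\<Sum>w\<in>W. c w *\<^sub>R w) = (\<Sum>w\<in>W. c' w *\<^sub>R w)" for c c'
    using that by simp
  \<comment> \<open>The new cells are the cones with apex ray \<open>w\<close> over those faces of old cells that can be seen
      from \<open>w\<close>. A point is located by going from it in direction \<open>- w\<close> to the last point before
      the old cone is first reached, i.e. by minimizing the coefficient of \<open>w\<close>.\<close>
  define visible where "visible \<sigma> \<longleftrightarrow>
      (\<forall>y\<in>convex_cone hull \<sigma>. \<forall>t>0. y + t *\<^sub>R w \<notin> convex_cone hull W)" for \<sigma>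
  define \<Delta>' where "\<Delta>' = \<Delta> \<union> {insert w \<tau> | \<tau> \<sigma>. \<sigma> \<in> \<Delta> \<and> \<tau> \<subseteq> \<sigma> \<and> visible \<tau>}"
  have fin: "finite \<sigma>" if "\<sigma> \<in> \<Delta>" for \<sigma>
    using that sub insert.hyps(1) by (metis PowD finite_subset subsetD)
  have notin: "w \<notin> \<sigma>" if "\<sigma> \<in> \<Delta>" for \<sigma>
    using that sub insert.hyps(2) by blast
  have "independent \<sigma>'" if mem: "\<sigma>' \<in> \<Delta>'" for \<sigma>'
  proof (cases "\<sigma>' \<in> \<Delta>")
    case False
    then obtain \<sigma> \<rho> where \<rho>: "\<rho> \<in> \<Delta>" "\<sigma> \<subseteq> \<rho>" and \<sigma>: "visible \<sigma>" "\<sigma>' = insert w \<sigma>"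
      using mem False unfolding \<Delta>'_def by blast
    \<comment> \<open>Otherwise \<open>w = u - v\<close> with \<open>u\<close> and \<open>v\<close>
      in the cone over \<sigma>, so one step along \<open>w\<close> from \<open>v\<close> ends at
      \<open>u\<close> inside the old cone, against visibility.\<close>
    have "w \<notin> span \<sigma>"
    proof
      assume "w \<in> span \<sigma>"
      then obtain u v where uv: "u \<in> convex_cone hull \<sigma>" "v \<in> convex_cone hull \<sigma>" "w = u - v"
        using span_eq_cone_diff fin[OF \<rho>(1)] \<rho>(2) by (metis finite_subset)
      then have "v + 1 *\<^sub>R w \<in> convex_cone hull W"
        using sub \<rho> hull_mono[of \<sigma> W convex_cone] by auto
      then show False
        using \<sigma>(1) uv(2) unfolding visible_def by (metis zero_less_one)
    qed
    then show ?thesis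
      using \<sigma> ind[OF \<rho>(1)] \<rho>(2) by (metis independent_insertI independent_mono)
  qed (simp add: ind)
  moreover have "x \<in> (\<Union>\<sigma>\<in>\<Delta>'. convex_cone hull \<sigma>)" if x: "x \<in> convex_cone hull (insert w W)" for x
  proof -
    \<comment> \<open>The infimum of \<open>T\<close> is attained: \<open>T\<close> is closed
      because finitely generated cones are closed, nonempty because \<open>x\<close> lies in the new
      cone, and bounded below by 0.\<close>
    define T where "T = {t. 0 \<le> t \<and> x - t *\<^sub>R w \<in> convex_cone hull W}"
    have "T = {0..} \<inter> (\<lambda>t. x - t *\<^sub>R w) -` (convex_cone hull W)"
      by (auto simp: T_def)
    moreover have "closed ((\<lambda>t. x - t *\<^sub>R w) -` (convex_cone hull W))"
      by (intro continuous_closed_vimage closed_convex_cone_hull insert.hyps(1))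
        (auto intro!: continuous_intros)
    ultimately have "closed T" by (simp add: closed_Int)
    moreover have "T \<noteq> {}"
      using x by (fastforce simp: T_def convex_cone_hull_insert)
    moreover have "bdd_below T" by (auto simp: T_def intro: bdd_belowI[of _ 0])
    ultimately have t: "Inf T \<in> T" using closed_contains_Inf by blast
    define t where "t = Inf T"
    have t0: "0 \<le> t" and y: "x - t *\<^sub>R w \<in> convex_cone hull W" using t by (auto simp: T_def t_def)
    have tmin: "t \<le> s" if "0 \<le> s" "x - s *\<^sub>R w \<in> convex_cone hull W" for s
      unfolding t_def using that \<open>bdd_below T\<close> by (intro cInf_lower) (auto simp: T_def)
    obtain \<sigma> where \<sigma>: "\<sigma> \<in> \<Delta>" and y\<sigma>: "x - t *\<^sub>R w \<in> convex_cone hull \<sigma>"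
      using cov y by blast
    show ?thesis
    proof (cases "t = 0")
      case True
      then show ?thesis using \<sigma> y\<sigma> by (auto simp: \<Delta>'_def)
    next
      case False
      then have "0 < t" using t0 by simp
      have \<sigma>W: "\<sigma> \<subseteq> W" using \<sigma> sub by blast
      obtain c where c: "\<And>v. v \<in> \<sigma> \<Longrightarrow> 0 \<le> c v" "x - t *\<^sub>R w = (\<Sum>v\<in>\<sigma>. c v *\<^sub>R v)"
        using y\<sigma> convex_cone_hull_finite[OF fin[OF \<sigma>]] by blast
      \<comment> \<open>On the support all coefficients are strictly positive, so a small multiple
        of any point of the cone over \<tau> can be subtracted without leaving that cone.\<close>
      define \<tau> where "\<tau> = {v\<in>\<sigma>. c v \<noteq> 0}"
      have \<tau>: "\<tau> \<subseteq> \<sigma>" "finite \<tau>" using fin[OF \<sigma>] by (auto simp: \<tau>_def)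
      have c\<tau>: "x - t *\<^sub>R w = (\<Sum>v\<in>\<tau>. c v *\<^sub>R v)"
        unfolding c(2) \<tau>_def using fin[OF \<sigma>] by (intro sum.mono_neutral_right) auto
      \<comment> \<open>If \<open>y + s *\<^sub>R w\<close> were in the old cone, adding
        \<open>e\<close> times it to \<open>x - t *\<^sub>R w - e *\<^sub>R y\<close> would put
        \<open>x - (t - e * s) *\<^sub>R w\<close> there, against the minimality of
        \<open>t\<close>.\<close>
      have "visible \<tau>"
        unfolding visible_def
      proof (intro ballI allI impI notI)
        fix y s assume y': "y \<in> convex_cone hull \<tau>" and s: "s > 0" "y + s *\<^sub>R w \<in> convex_cone hull W"
        obtain b where b: "y = (\<Sum>v\<in>\<tau>. b v *\<^sub>R v)"
          using y' convex_cone_hull_finite[OF \<tau>(2)] by blast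
        have "\<forall>\<^sub>F e in at_right 0. \<forall>v\<in>\<tau>. 0 < c v + e * - b v"
          using c(1) \<tau>(2) by (intro eventually_small_perturbation) (auto simp: \<tau>_def order_less_le)
        \<comment> \<open>The one-point index set specializes the perturbation lemma to a single
          inequality.\<close>
        moreover have "\<forall>\<^sub>F e in at_right 0. \<forall>v\<in>{()}. 0 < t + e * - s"
          using \<open>0 < t\<close> by (intro eventually_small_perturbation) auto
        ultimately have "\<forall>\<^sub>F e in at_right 0. 0 < e \<and> (\<forall>v\<in>\<tau>. 0 < c v + e * - b v) \<and> 0 < t + e * - s"
          using eventually_at_right_less by eventually_elim auto
        then obtain e where e: "0 < e" "\<forall>v\<in>\<tau>. 0 < c v + e * - b v" "0 < t + e * - s"
          using eventually_happens' trivial_limit_at_right_real by blast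
        have "(\<Sum>v\<in>\<tau>. (c v - e * b v) *\<^sub>R v) \<in> convex_cone hull W"
          using e(2) \<tau> \<sigma>W by (intro in_cone_support) (auto intro: less_imp_le)
        then have "(\<Sum>v\<in>\<tau>. (c v - e * b v) *\<^sub>R v) + e *\<^sub>R (y + s *\<^sub>R w) \<in> convex_cone hull W"
          using e(1) s(2) by (metis convex_cone_hull_add convex_cone_hull_mul less_imp_le)
        also have "(\<Sum>v\<in>\<tau>. (c v - e * b v) *\<^sub>R v) + e *\<^sub>R (y + s *\<^sub>R w) = x - (t - e * s) *\<^sub>R w"
          using c\<tau> by (simp add: b algebra_simps sum_subtractf scaleR_sum_right)
        finally have "t \<le> t - e * s" using e(3) by (intro tmin) auto
        then show False using mult_pos_pos[OF e(1) s(1)] by simp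
      qed
      then have "insert w \<tau> \<in> \<Delta>'" using \<sigma> \<tau>(1) by (auto simp: \<Delta>'_def)
      moreover have "x \<in> convex_cone hull (insert w \<tau>)"
        using c\<tau> t0 \<tau>(2) c(1) unfolding convex_cone_hull_insert
        by (intro CollectI exI[of _ t] exI[of _ "x - t *\<^sub>R w"]) (auto simp: \<tau>_def algebra_simps intro!: in_cone_support)
      ultimately show ?thesis by blast
    qed
  qed
  moreover have "\<forall>v\<in>insert w W. c v = c' v"
    if c: "\<forall>v\<in>insert w W. 0 \<le> c v \<and> 0 \<le> c' v"
      and s1: "\<exists>\<sigma>\<in>\<Delta>'. {v\<in>insert w W. c v \<noteq> 0} \<subseteq> \<sigma>"
      and s2: "\<exists>\<sigma>\<in>\<Delta>'. {v\<in>insert w W. c' v \<noteq> 0} \<subseteq> \<sigma>"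
      and eq: "(\<Sum>v\<in>insert w W. c v *\<^sub>R v) = (\<Sum>v\<in>insert w W. c' v *\<^sub>R v)" for c c'
  proof -
    \<comment> \<open>A combination supported in a cell uses the least possible amount of
      \<open>w\<close>. If \<open>b w\<close> were larger, its cell would be new with a visible
      base, yet the base part plus a positive multiple of \<open>w\<close> would be the old-cone
      point \<open>\<Sum>v\<in>W. a v *\<^sub>R v\<close>. Applied both ways, this gives equality at
      \<open>w\<close>.\<close>
    have le: "b w \<le> a w"
      if ab: "\<forall>v\<in>insert w W. 0 \<le> a v \<and> 0 \<le> b v"
      and s2: "\<exists>\<sigma>\<in>\<Delta>'. {v\<in>insert w W. b v \<noteq> 0} \<subseteq> \<sigma>"
      and eq: "(\<Sum>v\<in>insert w W. a v *\<^sub>R v) = (\<Sum>v\<in>insert w W. b v *\<^sub>R v)" for a b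
    proof (rule ccontr)
      assume "\<not> b w \<le> a w"
      then have lt: "a w < b w" by simp
      moreover have "0 \<le> a w" using ab by simp
      ultimately have "b w \<noteq> 0" by simp
      then obtain \<sigma> where \<sigma>: "visible \<sigma>" "{v\<in>insert w W. b v \<noteq> 0} \<subseteq> insert w \<sigma>"
        using s2 notin unfolding \<Delta>'_def by blast
      have "{v\<in>W. b v \<noteq> 0} \<subseteq> \<sigma>" using \<sigma>(2) insert.hyps(2) by auto
      then have "(\<Sum>v\<in>W. b v *\<^sub>R v) \<in> convex_cone hull \<sigma>"
        using ab insert.hyps(1) by (intro in_cone_support) auto
      moreover have "(\<Sum>v\<in>W. b v *\<^sub>R v) + (b w - a w) *\<^sub>R w = (\<Sum>v\<in>W. a v *\<^sub>R v)"
        using eq insert.hyps by (simp add: algebra_simps)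
      moreover have "(\<Sum>v\<in>W. a v *\<^sub>R v) \<in> convex_cone hull W"
        using ab insert.hyps(1) by (intro in_cone_support) auto
      ultimately show False
        using \<sigma>(1) lt unfolding visible_def by (metis diff_gt_0_iff_gt)
    qed
    have w: "c w = c' w"
      using le[of c c'] le[of c' c] c s1 s2 eq by fastforce
    \<comment> \<open>Deleting \<open>w\<close> from any cell leaves a subset of an old cell, so the
      induction hypothesis applies to the remaining coefficients.\<close>
    have "\<exists>\<sigma>\<in>\<Delta>. {v\<in>W. a v \<noteq> 0} \<subseteq> \<sigma>" if ex: "\<exists>\<sigma>\<in>\<Delta>'. {v\<in>insert w W. a v \<noteq> 0} \<subseteq> \<sigma>" for a :: "'a \<Rightarrow> real"
    proof -
      obtain \<sigma>' where \<sigma>': "\<sigma>' \<in> \<Delta>'" "{v\<in>insert w W. a v \<noteq> 0} \<subseteq> \<sigma>'" using ex by blast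
      then have "\<exists>\<sigma>\<in>\<Delta>. \<sigma>' - {w} \<subseteq> \<sigma>" by (auto simp: \<Delta>'_def)
      then show ?thesis using \<sigma>'(2) insert.hyps(2) by blast
    qed
    then have "\<forall>v\<in>W. c v = c' v"
      using c s1 s2 eq w insert.hyps by (intro uniq) auto
    with w show ?thesis by simp
  qed
  moreover have "\<Delta>' \<subseteq> Pow (insert w W)" using sub by (auto simp: \<Delta>'_def)
  ultimately show ?case
    by (intro exI[of _ \<Delta>'] conjI) (blast+)
qed

section \<open>Generic directions and half-open cells\<close>

text \<open>The weights are powers \<open>t ^ f w\<close> with distinct exponents on
  \<open>W\<close>. For each proper span, pairing with a suitable normal vector gives a nonzero
  polynomial in \<open>t\<close>, so all but finitely many \<open>t\<close> avoid all these finitely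
  many subspaces.\<close>

lemma generic_positive_combination:
  fixes W :: "'a::euclidean_space set"
  assumes "finite W"
  obtains a where "\<And>w. 0 < a w"
    "\<And>S. S \<subseteq> W \<Longrightarrow> (\<Sum>w\<in>W. a w *\<^sub>R w) \<in> span S \<Longrightarrow> span S = span W"
proof -
  obtain f :: "'a \<Rightarrow> nat" where f: "inj_on f W"
    using finite_imp_inj_to_nat_seg[OF assms] by blast
  define p where "p z = (\<Sum>w\<in>W. monom (z \<bullet> w) (f w))" for z
  \<comment> \<open>Take \<open>z\<close> to be the component orthogonal to \<open>span S\<close> of
    some \<open>w\<close> outside that span. As \<open>f\<close> is injective, the coefficient of
    \<open>p z\<close> at \<open>f w\<close> is \<open>z \<bullet> w = z \<bullet> z\<close>, which
    is nonzero.\<close>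
  have "\<exists>z. (\<forall>s\<in>span S. z \<bullet> s = 0) \<and> p z \<noteq> 0" if S: "S \<subseteq> W" "span S \<noteq> span W" for S
  proof -
    obtain w where w: "w \<in> W" "w \<notin> span S"
      using S by (metis span_eq span_mono span_superset subsetI subset_trans)
    obtain y z where yz: "y \<in> span S" "\<And>s. s \<in> span S \<Longrightarrow> orthogonal z s" "w = y + z"
      using orthogonal_subspace_decomp_exists by blast
    have "z \<noteq> 0" using w(2) yz by auto
    moreover have "poly.coeff (p z) (f w) = (\<Sum>v\<in>W. if v = w then z \<bullet> v else 0)"
      unfolding p_def coeff_sum coeff_monom using f w(1)
      by (intro sum.cong refl if_cong) (auto simp: inj_on_eq_iff)
    then have "poly.coeff (p z) (f w) = z \<bullet> w"
      using w(1) assms by simp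
    then have "poly.coeff (p z) (f w) = z \<bullet> z"
      using yz by (simp add: inner_add_right orthogonal_def)
    ultimately have "p z \<noteq> 0" by (metis coeff_0 inner_eq_zero_iff)
    then show ?thesis using yz(2) by (auto simp: orthogonal_def)
  qed
  then obtain z where z: "\<And>S s. S \<subseteq> W \<Longrightarrow> span S \<noteq> span W \<Longrightarrow> s \<in> span S \<Longrightarrow> z S \<bullet> s = 0"
    "\<And>S. S \<subseteq> W \<Longrightarrow> span S \<noteq> span W \<Longrightarrow> p (z S) \<noteq> 0" by metis
  have "finite (\<Union>S\<in>{S\<in>Pow W. span S \<noteq> span W}. {t. poly (p (z S)) t = 0})"
    using assms z(2) by (intro finite_UN_I poly_roots_finite) auto
  then obtain t where t: "0 < t" "t \<notin> (\<Union>S\<in>{S\<in>Pow W. span S \<noteq> span W}. {t. poly (p (z S)) t = 0})"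
    using infinite_Ioi[of "0::real"] by (meson finite_subset greaterThan_iff subsetI)
  show thesis
  proof
    show "0 < t ^ f w" for w using t(1) by simp
    show "span S = span W" if S: "S \<subseteq> W" and q: "(\<Sum>w\<in>W. t ^ f w *\<^sub>R w) \<in> span S" for S
    proof (rule ccontr)
      assume ne: "span S \<noteq> span W"
      have "poly (p (z S)) t = z S \<bullet> (\<Sum>w\<in>W. t ^ f w *\<^sub>R w)"
        by (simp add: p_def poly_sum poly_monom inner_sum_right mult.commute)
      also have "\<dots> = 0" by (rule z(1)[OF S ne q])
      finally show False using t(2) S ne by blast
    qed
  qed
qed

lemma representation_lincomb:
  fixes B :: "'a::real_vector set"
  assumes "independent B" "finite B"
  shows "representation B (\<Sum>w\<in>B. c w *\<^sub>R w) = (\<lambda>w. if w \<in> B then c w else 0)"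
proof -
  have "representation B (\<Sum>w\<in>B. c w *\<^sub>R w) = (\<lambda>b. \<Sum>w\<in>B. representation B (c w *\<^sub>R w) b)"
    using assms(1) by (intro real_vector.representation_sum) (auto intro: span_base span_scale)
  also have "\<dots> = (\<lambda>w. if w \<in> B then c w else 0)"
    using assms by (auto simp: representation_scale representation_basis span_base fun_eq_iff
        if_distrib[of "(*) _"] cong: if_cong)
  finally show ?thesis .
qed

text \<open>
  The points \<open>x\<close> for which \<open>x + e *\<^sub>R q\<close> lies in the open simplicial cone over \<open>B\<close> for all small
  \<open>e > 0\<close>, provided that no coordinate of \<open>q\<close> vanishes.
\<close>

definition half_open_cone :: "'a::real_vector \<Rightarrow> 'a set \<Rightarrow> 'a set" where
  "half_open_cone q B = {x \<in> span B. \<forall>w\<in>B. 0 \<le> representation B x w \<and>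
     (representation B q w < 0 \<longrightarrow> 0 < representation B x w)}"

text \<open>A point \<open>x\<close> is assigned to the cell containing
  \<open>x + e *\<^sub>R q\<close> for all small \<open>e > 0\<close>. For generic \<open>q\<close>
  this displaced point eventually lies on no wall, so exactly one cell qualifies. Positivity of the
  weights is returned as well, because it later gives \<open>q\<close> positive height.\<close>

lemma half_open_decomposition:
  fixes W :: "'a::euclidean_space set"
  assumes "finite W"
  obtains a \<Delta> where "\<And>w. 0 < a w" "\<And>\<sigma>. \<sigma> \<in> \<Delta> \<Longrightarrow> \<sigma> \<subseteq> W \<and> independent \<sigma> \<and> span \<sigma> = span W"
    "disjoint_family_on (half_open_cone (\<Sum>w\<in>W. a w *\<^sub>R w)) \<Delta>"
    "(\<Union>\<sigma>\<in>\<Delta>. half_open_cone (\<Sum>w\<in>W. a w *\<^sub>R w) \<sigma>) = convex_cone hull W"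
proof -
  obtain a where a: "\<And>w. 0 < a w"
    "\<And>S. S \<subseteq> W \<Longrightarrow> (\<Sum>w\<in>W. a w *\<^sub>R w) \<in> span S \<Longrightarrow> span S = span W"
    using generic_positive_combination[OF assms] by blast
  define q where "q = (\<Sum>w\<in>W. a w *\<^sub>R w)"
  have gen: "span S = span W" if "S \<subseteq> W" "q \<in> span S" for S
    using a(2) that q_def by blast
  have qW: "q \<in> convex_cone hull W"
    unfolding q_def using a(1) assms by (intro in_cone_support) (auto intro: less_imp_le)
  have cone_span: "convex_cone hull S \<subseteq> span S" for S :: "'a set"
    by (intro hull_minimal) (auto simp: convex_cone_iff span_zero span_add span_scale span_base)
  obtain \<Delta>0 where sub: "\<Delta>0 \<subseteq> Pow W" and ind: "\<And>\<sigma>. \<sigma> \<in> \<Delta>0 \<Longrightarrow> independent \<sigma>"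
    and cov: "convex_cone hull W \<subseteq> (\<Union>\<sigma>\<in>\<Delta>0. convex_cone hull \<sigma>)"
    and uniq: "\<forall>c c'. (\<forall>w\<in>W. 0 \<le> c w \<and> 0 \<le> c' w)
           \<longrightarrow> (\<exists>\<sigma>\<in>\<Delta>0. {w\<in>W. c w \<noteq> 0} \<subseteq> \<sigma>) \<longrightarrow> (\<exists>\<sigma>\<in>\<Delta>0. {w\<in>W. c' w \<noteq> 0} \<subseteq> \<sigma>)
           \<longrightarrow> (\<Sum>w\<in>W. c w *\<^sub>R w) = (\<Sum>w\<in>W. c' w *\<^sub>R w) \<longrightarrow> (\<forall>w\<in>W. c w = c' w)"
    using placing_triangulation[OF assms] by (elim exE conjE) blast
  \<comment> \<open>Cells that do not span can be discarded: by genericity \<open>q\<close> is not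
    in their span, so a ray in direction \<open>q\<close> meets each of them at most once.\<close>
  define \<Delta> where "\<Delta> = {\<sigma>\<in>\<Delta>0. span \<sigma> = span W}"
  have fin: "finite \<sigma>" if "\<sigma> \<in> \<Delta>0" for \<sigma>
    using that sub assms by (metis PowD finite_subset subsetD)
  have qspan: "q \<in> span \<sigma>" if "\<sigma> \<in> \<Delta>" for \<sigma>
    using that qW cone_span by (auto simp: \<Delta>_def)
  have rep: "representation \<sigma> (x + e *\<^sub>R q) w = representation \<sigma> x w + e * representation \<sigma> q w"
    if "\<sigma> \<in> \<Delta>" "x \<in> span \<sigma>" for \<sigma> x e w
    using that qspan[OF that(1)] ind by (simp add: \<Delta>_def representation_add representation_scale span_scale)
  \<comment> \<open>A zero coordinate would put \<open>q\<close> in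
    \<open>span (\<sigma> - {w})\<close>. By genericity that would be the full span, contradicting
    independence.\<close>
  have q_nz: "representation \<sigma> q w \<noteq> 0" if \<sigma>: "\<sigma> \<in> \<Delta>" and w: "w \<in> \<sigma>" for \<sigma> w
  proof
    assume 0: "representation \<sigma> q w = 0"
    have "q = (\<Sum>v\<in>\<sigma>. representation \<sigma> q v *\<^sub>R v)"
      using \<sigma> ind fin qspan by (simp add: \<Delta>_def real_vector.sum_representation_eq)
    also have "\<dots> = (\<Sum>v\<in>\<sigma> - {w}. representation \<sigma> q v *\<^sub>R v)"
      using 0 \<sigma> fin by (intro sum.mono_neutral_right) (auto simp: \<Delta>_def)
    also have "\<dots> \<in> span (\<sigma> - {w})" by (intro span_sum span_scale span_base)
    finally have "span (\<sigma> - {w}) = span W"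
      using \<sigma> sub by (intro gen) (auto simp: \<Delta>_def)
    then have "w \<in> span (\<sigma> - {w})" using \<sigma> w by (auto simp: \<Delta>_def intro: span_base)
    then show False using ind \<sigma> w by (auto simp: \<Delta>_def dependent_def)
  qed
  have pos: "\<forall>\<^sub>F e in at_right 0. \<forall>w\<in>\<sigma>. 0 < representation \<sigma> (x + e *\<^sub>R q) w"
    if \<sigma>: "\<sigma> \<in> \<Delta>" and x: "x \<in> half_open_cone q \<sigma>" for \<sigma> x
  proof (intro eventually_ball_finite ballI)
    show "finite \<sigma>" using \<sigma> fin by (simp add: \<Delta>_def)
    fix w assume w: "w \<in> \<sigma>"
    have xs: "x \<in> span \<sigma>" using x by (simp add: half_open_cone_def)
    consider "0 < representation \<sigma> x w" | "representation \<sigma> x w = 0" "0 < representation \<sigma> q w"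
      using x w q_nz[OF \<sigma> w] unfolding half_open_cone_def by force
    then show "\<forall>\<^sub>F e in at_right 0. 0 < representation \<sigma> (x + e *\<^sub>R q) w"
    proof cases
      case 1
      then show ?thesis
        using eventually_small_perturbation[of "{w}" "representation \<sigma> x" "representation \<sigma> q"]
        by (simp add: rep[OF \<sigma> xs])
    next
      case 2
      show ?thesis
        by (rule eventually_mono[OF eventually_at_right_less]) (simp add: 2 rep[OF \<sigma> xs])
    qed
  qed
  \<comment> \<open>For a common small \<open>e\<close>, the point \<open>x + e *\<^sub>R q\<close>
    is interior to both cells. Its coefficients then have supports exactly \<sigma> and \<tau>, and
    uniqueness in the triangulation identifies them.\<close>
  have disj: "\<sigma> = \<tau>" if st: "\<sigma> \<in> \<Delta>" "\<tau> \<in> \<Delta>" and x: "x \<in> half_open_cone q \<sigma>" "x \<in> half_open_cone q \<tau>" for \<sigma> \<tau> x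
  proof -
    have "\<forall>\<^sub>F e in at_right 0. (\<forall>w\<in>\<sigma>. 0 < representation \<sigma> (x + e *\<^sub>R q) w) \<and>
        (\<forall>w\<in>\<tau>. 0 < representation \<tau> (x + e *\<^sub>R q) w)"
      using pos st x by (intro eventually_conj)
    then obtain e where e: "\<forall>w\<in>\<sigma>. 0 < representation \<sigma> (x + e *\<^sub>R q) w"
        "\<forall>w\<in>\<tau>. 0 < representation \<tau> (x + e *\<^sub>R q) w"
      using eventually_happens' trivial_limit_at_right_real by blast
    define y where "y = x + e *\<^sub>R q"
    have props: "\<rho> \<subseteq> W" "{w\<in>W. representation \<rho> y w \<noteq> 0} = \<rho>" "\<forall>w\<in>W. 0 \<le> representation \<rho> y w"
      "(\<Sum>w\<in>W. representation \<rho> y w *\<^sub>R w) = y"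
      if \<rho>: "\<rho> \<in> \<Delta>" "x \<in> half_open_cone q \<rho>" "\<forall>w\<in>\<rho>. 0 < representation \<rho> y w" for \<rho>
    proof -
      show \<rho>W: "\<rho> \<subseteq> W" using \<rho>(1) sub by (auto simp: \<Delta>_def)
      have out: "representation \<rho> y w = 0" if "w \<notin> \<rho>" for w
        using that representation_ne_zero by blast
      show "{w\<in>W. representation \<rho> y w \<noteq> 0} = \<rho>"
        using out \<rho>(3) \<rho>W by force
      show "\<forall>w\<in>W. 0 \<le> representation \<rho> y w"
        using out \<rho>(3) by (metis less_imp_le order_refl)
      have "y \<in> span \<rho>"
        using \<rho>(2) qspan[OF \<rho>(1)] by (auto simp: y_def half_open_cone_def span_add span_scale)
      then show "(\<Sum>w\<in>W. representation \<rho> y w *\<^sub>R w) = y"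
        using \<rho>(1) ind \<rho>W assms by (intro real_vector.sum_representation_eq) (auto simp: \<Delta>_def)
    qed
    note ps = props[OF st(1) x(1) e(1)[folded y_def]] props[OF st(2) x(2) e(2)[folded y_def]]
    have "representation \<sigma> y w = representation \<tau> y w" if "w \<in> W" for w
    proof (rule uniq[rule_format, OF _ _ _ _ that])
      show "0 \<le> representation \<sigma> y v \<and> 0 \<le> representation \<tau> y v" if "v \<in> W" for v
        using ps(3,7) that by blast
      show "\<exists>\<rho>\<in>\<Delta>0. {w \<in> W. representation \<sigma> y w \<noteq> 0} \<subseteq> \<rho>"
        "\<exists>\<rho>\<in>\<Delta>0. {w \<in> W. representation \<tau> y w \<noteq> 0} \<subseteq> \<rho>"
        unfolding ps(2,6) using st by (auto simp: \<Delta>_def)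
      show "(\<Sum>w\<in>W. representation \<sigma> y w *\<^sub>R w) = (\<Sum>w\<in>W. representation \<tau> y w *\<^sub>R w)"
        unfolding ps(4,8) ..
    qed
    then have "{w\<in>W. representation \<sigma> y w \<noteq> 0} = {w\<in>W. representation \<tau> y w \<noteq> 0}"
      by auto
    then show ?thesis unfolding ps(2,6) .
  qed
  have "x \<in> (\<Union>\<sigma>\<in>\<Delta>. half_open_cone q \<sigma>)" if x: "x \<in> convex_cone hull W" for x
  proof -
    \<comment> \<open>As there are finitely many cells, a single one contains
      \<open>x + e *\<^sub>R q\<close> for arbitrarily small \<open>e > 0\<close>.\<close>
    have "\<forall>\<^sub>F e in at_right 0. \<exists>\<sigma>\<in>\<Delta>0. x + e *\<^sub>R q \<in> convex_cone hull \<sigma>"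
      using eventually_at_right_less
    proof eventually_elim
      case (elim e)
      then have "x + e *\<^sub>R q \<in> convex_cone hull W"
        using x qW by (intro convex_cone_hull_add convex_cone_hull_mul) auto
      then show ?case using cov by blast
    qed
    then have "\<exists>\<^sub>F e in at_right 0. \<exists>\<sigma>\<in>\<Delta>0. x + e *\<^sub>R q \<in> convex_cone hull \<sigma>"
      by (rule eventually_frequently[rotated]) simp
    moreover have "finite \<Delta>0" using sub assms by (metis finite_Pow_iff finite_subset)
    ultimately have "\<exists>\<sigma>\<in>\<Delta>0. \<exists>\<^sub>F e in at_right 0. x + e *\<^sub>R q \<in> convex_cone hull \<sigma>"
      by (intro frequently_bex_finite)
    then obtain \<sigma> where \<sigma>0: "\<sigma> \<in> \<Delta>0" and freq: "\<exists>\<^sub>F e in at_right 0. x + e *\<^sub>R q \<in> convex_cone hull \<sigma>"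
      by blast
    have ex: "\<exists>e. 0 < e \<and> P e \<and> x + e *\<^sub>R q \<in> convex_cone hull \<sigma>" if "\<forall>\<^sub>F e in at_right 0. P e" for P
    proof -
      have "\<exists>\<^sub>F e in at_right 0. (0 < e \<and> P e) \<and> x + e *\<^sub>R q \<in> convex_cone hull \<sigma>"
        using frequently_eventually_conj[OF freq eventually_conj[OF eventually_at_right_less that]] by simp
      from frequently_ex[OF this] show ?thesis by blast
    qed
    obtain e1 where e1: "0 < e1" "x + e1 *\<^sub>R q \<in> convex_cone hull \<sigma>"
      using ex[of "\<lambda>_. True"] by auto
    obtain e2 where e2: "0 < e2" "e2 < e1" "x + e2 *\<^sub>R q \<in> convex_cone hull \<sigma>"
      using ex[of "\<lambda>e. e < e1"] e1(1) eventually_at_right_less[of 0]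
      by (metis eventually_at_right_field)
    \<comment> \<open>Two distinct points of the ray lie in \<open>span \<sigma>\<close>, hence so
      does \<open>q\<close>, and \<sigma> is one of the retained cells.\<close>
    have "(x + e1 *\<^sub>R q) - (x + e2 *\<^sub>R q) \<in> span \<sigma>"
      using e1(2) e2(3) cone_span by (intro span_diff) auto
    then have "(e1 - e2) *\<^sub>R q \<in> span \<sigma>" by (simp add: algebra_simps)
    then have "(1 / (e1 - e2)) *\<^sub>R ((e1 - e2) *\<^sub>R q) \<in> span \<sigma>" by (rule span_scale)
    moreover have "(1 / (e1 - e2)) *\<^sub>R ((e1 - e2) *\<^sub>R q) = q"
      unfolding scaleR_scaleR using e2(2) by simp
    ultimately have "q \<in> span \<sigma>" by metis
    then have \<sigma>: "\<sigma> \<in> \<Delta>" using gen[of \<sigma>] \<sigma>0 sub by (auto simp: \<Delta>_def)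
    have "(x + e1 *\<^sub>R q) - e1 *\<^sub>R q \<in> span \<sigma>"
      using e1(2) cone_span \<open>q \<in> span \<sigma>\<close> by (intro span_diff span_scale) auto
    then have xs: "x \<in> span \<sigma>" by simp
    have ge: "0 \<le> representation \<sigma> x w + e * representation \<sigma> q w"
      if xe: "x + e *\<^sub>R q \<in> convex_cone hull \<sigma>" for e w
    proof -
      obtain c where "x + e *\<^sub>R q = (\<Sum>v\<in>\<sigma>. c v *\<^sub>R v)" "\<forall>v\<in>\<sigma>. 0 \<le> c v"
        using xe convex_cone_hull_finite[OF fin[OF \<sigma>0]] by blast
      then have "0 \<le> representation \<sigma> (x + e *\<^sub>R q) w"
        using representation_lincomb[OF ind fin, OF \<sigma>0 \<sigma>0, of c] by simp
      then show ?thesis by (simp add: rep[OF \<sigma> xs])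
    qed
    \<comment> \<open>A negative coordinate of \<open>x\<close> would stay negative for all small
      \<open>e\<close>, although the ray is in the cone over \<sigma> for arbitrarily small
      \<open>e\<close>.\<close>
    have "0 \<le> representation \<sigma> x w" for w
    proof (rule ccontr)
      assume "\<not> 0 \<le> representation \<sigma> x w"
      then have "\<forall>\<^sub>F e in at_right 0. \<forall>v\<in>{w}. 0 < - representation \<sigma> x v + e * - representation \<sigma> q v"
        by (intro eventually_small_perturbation) auto
      from ex[OF this] obtain e where
        "0 < - representation \<sigma> x w + e * - representation \<sigma> q w" "x + e *\<^sub>R q \<in> convex_cone hull \<sigma>"
        by blast
      with ge[of e w] show False by simp
    qed
    moreover have "0 < representation \<sigma> x w" if "representation \<sigma> q w < 0" for w
      using ge[OF e1(2), of w] mult_pos_neg[OF e1(1) that] by linarith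
    ultimately show ?thesis using \<sigma> xs by (auto simp: half_open_cone_def)
  qed
  moreover have "half_open_cone q \<sigma> \<subseteq> convex_cone hull W" if \<sigma>: "\<sigma> \<in> \<Delta>" for \<sigma>
  proof
    fix x assume x: "x \<in> half_open_cone q \<sigma>"
    have "x = (\<Sum>w\<in>\<sigma>. representation \<sigma> x w *\<^sub>R w)"
      using x \<sigma> ind fin by (simp add: half_open_cone_def \<Delta>_def real_vector.sum_representation_eq)
    also have "\<dots> \<in> convex_cone hull W"
      using x \<sigma> fin sub by (intro in_cone_support) (auto simp: half_open_cone_def \<Delta>_def)
    finally show "x \<in> convex_cone hull W" .
  qed
  ultimately have "(\<Union>\<sigma>\<in>\<Delta>. half_open_cone q \<sigma>) = convex_cone hull W" by blast
  moreover have "disjoint_family_on (half_open_cone q) \<Delta>"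
    unfolding disjoint_family_on_def using disj by blast
  moreover have "\<sigma> \<subseteq> W \<and> independent \<sigma> \<and> span \<sigma> = span W" if "\<sigma> \<in> \<Delta>" for \<sigma>
    using that sub ind by (auto simp: \<Delta>_def)
  ultimately show thesis using that[of a \<Delta>] a(1) unfolding q_def by blast
qed

section \<open>Polynomial functions on tuples of natural numbers\<close>

definition polyfun :: "(('k::finite \<Rightarrow> nat) \<Rightarrow> rat) \<Rightarrow> bool" where
  "polyfun g \<longleftrightarrow> (\<exists>p. \<forall>n. multi_eval p (\<lambda>j. of_nat (n j)) = g n)"

text \<open>Summing over a common finite superset of the keys lets polynomials with different
  supports be added or compared term by term.\<close>

lemma multi_eval_superset:
  assumes "finite A" "Poly_Mapping.keys p \<subseteq> A"
  shows "multi_eval p x = (\<Sum>\<alpha>\<in>A. Poly_Mapping.lookup p \<alpha> * (\<Prod>j\<in>UNIV. x j ^ \<alpha> j))"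
  unfolding multi_eval_def
  by (rule sum.mono_neutral_left) (use assms in \<open>auto simp: Poly_Mapping.in_keys_iff\<close>)

lemma multi_eval_add: "multi_eval (p + q) x = multi_eval p x + multi_eval q x"
proof -
  let ?A = "Poly_Mapping.keys p \<union> Poly_Mapping.keys q"
  have "Poly_Mapping.keys (p + q) \<subseteq> ?A" by (rule Poly_Mapping.keys_add)
  then show ?thesis
    using multi_eval_superset[of ?A "p + q" x] multi_eval_superset[of ?A p x]
      multi_eval_superset[of ?A q x]
    by (simp add: lookup_add distrib_right sum.distrib)
qed

lemma multi_eval_single:
  "multi_eval (Poly_Mapping.single \<alpha> c) x = c * (\<Prod>j\<in>UNIV. x j ^ \<alpha> j)"
  using multi_eval_superset[of "{\<alpha>}" "Poly_Mapping.single \<alpha> c" x] by simp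

lemma polyfun_monom: "polyfun (\<lambda>n. c * (\<Prod>j\<in>UNIV. of_nat (n j) ^ \<alpha> j))"
  unfolding polyfun_def by (metis multi_eval_single)

lemma polyfun_add: "polyfun g \<Longrightarrow> polyfun h \<Longrightarrow> polyfun (\<lambda>n. g n + h n)"
  unfolding polyfun_def by (metis multi_eval_add)

lemma polyfun_0: "polyfun (\<lambda>_. 0)"
  using polyfun_monom[of 0] by simp

lemma polyfun_sum: "(\<And>i. i \<in> I \<Longrightarrow> polyfun (g i)) \<Longrightarrow> polyfun (\<lambda>n. \<Sum>i\<in>I. g i n)"
  by (induction I rule: infinite_finite_induct) (auto intro: polyfun_0 polyfun_add)

lemma polyfun_sumE:
  assumes "polyfun g"
  obtains A :: "('k::finite \<Rightarrow> nat) set" and c where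
    "finite A" "\<And>n. g n = (\<Sum>\<alpha>\<in>A. c \<alpha> * (\<Prod>j\<in>UNIV. of_nat (n j) ^ \<alpha> j))"
  using assms unfolding polyfun_def multi_eval_def by (metis finite_keys)

lemma polyfun_mult:
  assumes "polyfun g" "polyfun h"
  shows "polyfun (\<lambda>n. g n * h n)"
proof -
  obtain A c where A: "finite A" "\<And>n. g n = (\<Sum>\<alpha>\<in>A. c \<alpha> * (\<Prod>j\<in>UNIV. of_nat (n j) ^ \<alpha> j))"
    using polyfun_sumE[OF assms(1)] by blast
  obtain B d where B: "finite B" "\<And>n. h n = (\<Sum>\<beta>\<in>B. d \<beta> * (\<Prod>j\<in>UNIV. of_nat (n j) ^ \<beta> j))"
    using polyfun_sumE[OF assms(2)] by blast
  have "g n * h n = (\<Sum>\<alpha>\<in>A. \<Sum>\<beta>\<in>B. c \<alpha> * d \<beta> * (\<Prod>j\<in>UNIV. of_nat (n j) ^ (\<alpha> j + \<beta> j)))" for n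
    unfolding A(2) B(2) sum_product
    by (intro sum.cong) (auto simp: power_add prod.distrib mult_ac)
  then show ?thesis by (simp add: polyfun_sum polyfun_monom)
qed

lemma polyfun_const: "polyfun (\<lambda>_. c)"
  using polyfun_monom[of c "\<lambda>_. 0"] by simp

lemma polyfun_prod: "(\<And>i. i \<in> I \<Longrightarrow> polyfun (g i)) \<Longrightarrow> polyfun (\<lambda>n. \<Prod>i\<in>I. g i n)"
  by (induction I rule: infinite_finite_induct) (auto intro: polyfun_const polyfun_mult)

lemma polyfun_coord: "polyfun (\<lambda>n. of_nat (n j))"
proof -
  have "(\<Prod>i\<in>UNIV. of_nat (n i) ^ (if i = j then 1 else 0)) = (of_nat (n j) :: rat)" for n
    by (simp add: if_distrib[of "power _"] cong: if_cong)
  then show ?thesis using polyfun_monom[of 1 "\<lambda>i. if i = j then 1 else 0"] by simp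
qed

text \<open>The binomial coefficient is a product of \<open>r\<close> factors linear in
  \<open>n j\<close>, divided by \<open>r!\<close>. This is also right for
  \<open>n j + t < r\<close>, where one factor vanishes.\<close>

lemma polyfun_binomial: "polyfun (\<lambda>n. of_nat ((n j + t) choose r))"
proof -
  have "of_nat ((n j + t) choose r)
      = (\<Prod>i<r. (of_nat (n j) + (of_nat t - of_nat i))) * (1 / fact r :: rat)" for n :: "'a \<Rightarrow> nat"
    unfolding binomial_gbinomial gbinomial_prod_rev
    by (simp add: algebra_simps atLeast0LessThan)
  then show ?thesis
    by (simp only:) (intro polyfun_mult polyfun_prod polyfun_add polyfun_const polyfun_coord)
qed

section \<open>Uniqueness of polynomials from their values at natural numbers\<close>

lemma poly_eqI_nat:
  fixes p q :: "rat poly"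
  assumes "\<And>n. poly p (of_nat n) = poly q (of_nat n)"
  shows "p = q"
proof (rule ccontr)
  assume "p \<noteq> q"
  then have "finite {x. poly (p - q) x = 0}" by (intro poly_roots_finite) simp
  moreover have "range of_nat \<subseteq> {x. poly (p - q) x = 0}" using assms by auto
  ultimately have "finite (range (of_nat :: nat \<Rightarrow> rat))" by (rule finite_subset[rotated])
  then show False by (metis finite_imageD inj_of_nat infinite_UNIV_nat)
qed

text \<open>Induction on the variables, reducing to one-variable polynomials. Exponent vectors
  remain functions on the whole index type; injectivity of the restriction ensures that distinct
  members of \<open>A\<close> give distinct monomials in the variables of \<open>J\<close>.\<close>

lemma coefficients_zero:
  fixes c :: "('k::finite \<Rightarrow> nat) \<Rightarrow> rat"
  assumes "finite J" "finite A" "inj_on (\<lambda>\<alpha>. restrict \<alpha> J) A"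
    "\<And>n :: 'k \<Rightarrow> nat. (\<Sum>\<alpha>\<in>A. c \<alpha> * (\<Prod>j\<in>J. of_nat (n j) ^ \<alpha> j)) = 0"
  shows "\<forall>\<alpha>\<in>A. c \<alpha> = 0"
  using assms
proof (induction J arbitrary: A rule: finite_induct)
  case empty
  show ?case
  proof
    fix \<alpha> assume "\<alpha> \<in> A"
    then have "A = {\<alpha>}" using empty.prems(2) by (auto dest: inj_onD)
    then show "c \<alpha> = 0" using empty.prems(3) by simp
  qed
next
  case (insert i J)
  \<comment> \<open>Sort by the exponent \<open>m\<close> of the new variable: with the other values
    fixed, the inner sum is the coefficient at \<open>m\<close> of \<open>?p\<close>, which vanishes
    at every natural value of \<open>n i\<close>.\<close>
  have "\<forall>\<alpha>\<in>{\<alpha>\<in>A. \<alpha> i = m}. c \<alpha> = 0" for m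
  proof (rule insert.IH)
    show "finite {\<alpha> \<in> A. \<alpha> i = m}" using insert.prems(1) by simp
    show "inj_on (\<lambda>\<alpha>. restrict \<alpha> J) {\<alpha> \<in> A. \<alpha> i = m}"
    proof (rule inj_onI)
      fix \<alpha> \<beta> assume ab: "\<alpha> \<in> {\<alpha> \<in> A. \<alpha> i = m}" "\<beta> \<in> {\<alpha> \<in> A. \<alpha> i = m}" "restrict \<alpha> J = restrict \<beta> J"
      then have "restrict \<alpha> (insert i J) = restrict \<beta> (insert i J)"
        by (auto simp: restrict_def fun_eq_iff split: if_splits)
      then show "\<alpha> = \<beta>" by (rule inj_onD[OF insert.prems(2)]) (use ab(1,2) in simp_all)
    qed
    fix n :: "'k \<Rightarrow> nat"
    let ?g = "\<lambda>\<alpha>. c \<alpha> * (\<Prod>j\<in>J. of_nat (n j) ^ \<alpha> j)"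
    let ?p = "\<Sum>\<alpha>\<in>A. monom (?g \<alpha>) (\<alpha> i)"
    have "?p = 0"
    proof (rule poly_eqI_nat)
      fix x :: nat
      have "(\<Sum>\<alpha>\<in>A. c \<alpha> * (\<Prod>j\<in>insert i J. of_nat ((n(i := x)) j) ^ \<alpha> j)) = 0"
        by (rule insert.prems(3))
      also have "(\<Sum>\<alpha>\<in>A. c \<alpha> * (\<Prod>j\<in>insert i J. of_nat ((n(i := x)) j) ^ \<alpha> j))
          = (\<Sum>\<alpha>\<in>A. ?g \<alpha> * of_nat x ^ \<alpha> i)"
      proof (rule sum.cong)
        fix \<alpha>
        have "(\<Prod>j\<in>J. of_nat ((n(i := x)) j) ^ \<alpha> j) = (\<Prod>j\<in>J. of_nat (n j) ^ \<alpha> j :: rat)"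
          using insert.hyps(2) by (intro prod.cong) auto
        then show "c \<alpha> * (\<Prod>j\<in>insert i J. of_nat ((n(i := x)) j) ^ \<alpha> j) = ?g \<alpha> * of_nat x ^ \<alpha> i"
          using insert.hyps by (simp add: mult_ac)
      qed simp
      finally show "poly ?p (of_nat x) = poly 0 (of_nat x)"
        by (simp add: poly_sum poly_monom)
    qed
    then have "poly.coeff ?p m = 0" by simp
    then show "(\<Sum>\<alpha>\<in>{\<alpha> \<in> A. \<alpha> i = m}. ?g \<alpha>) = 0"
      using insert.prems(1) by (simp add: coeff_sum sum.If_cases Int_def Collect_conj_eq[symmetric] conj_commute)
  qed
  then show ?case by blast
qed

lemma multi_eval_inject:
  fixes p q :: "('k::finite \<Rightarrow> nat) \<Rightarrow>\<^sub>0 rat"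
  assumes "\<And>n :: 'k \<Rightarrow> nat. multi_eval p (\<lambda>j. of_nat (n j)) = multi_eval q (\<lambda>j. of_nat (n j))"
  shows "p = q"
proof -
  let ?A = "Poly_Mapping.keys p \<union> Poly_Mapping.keys q"
  have "\<forall>\<alpha>\<in>?A. Poly_Mapping.lookup p \<alpha> - Poly_Mapping.lookup q \<alpha> = 0"
  proof (rule coefficients_zero[of UNIV])
    fix n :: "'k \<Rightarrow> nat"
    show "(\<Sum>\<alpha>\<in>?A. (Poly_Mapping.lookup p \<alpha> - Poly_Mapping.lookup q \<alpha>) * (\<Prod>j\<in>UNIV. of_nat (n j) ^ \<alpha> j)) = 0"
      using assms[of n] multi_eval_superset[of ?A p] multi_eval_superset[of ?A q]
      by (simp add: left_diff_distrib sum_subtractf)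
  qed (auto simp: inj_on_def restrict_UNIV)
  then show ?thesis
    by (intro poly_mapping_eqI) (metis UnCI eq_iff_diff_eq_0 in_keys_iff)
qed

text \<open>Complementation turns the supersets of \<open>S\<close> into the subsets of
  \<open>- S\<close>, and the signed sum is the expansion of the product of \<open>1 - 1\<close>
  over \<open>- S\<close>.\<close>

lemma alternating_sum_supersets:
  fixes S :: "'k::finite set"
  shows "(\<Sum>J | S \<subseteq> J. (-1) ^ (CARD('k) - card J)) = (if S = UNIV then 1 else 0 :: rat)"
proof -
  have "(\<Sum>J | S \<subseteq> J. (-1) ^ (CARD('k) - card J)) = (\<Sum>T\<in>Pow (- S). (-1) ^ card T :: rat)"
  proof (rule sum.reindex_bij_witness[of _ uminus uminus])
    fix J :: "'k set"
    show "(-1) ^ card (- J) = ((-1) ^ (CARD('k) - card J) :: rat)"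
      by (simp add: Compl_eq_Diff_UNIV card_Diff_subset)
  qed auto
  also have "\<dots> = (if S = UNIV then 1 else 0)"
  proof (cases "S = UNIV")
    case False
    then obtain x where "x \<in> - S" by blast
    then have "0 < card (- S)" by (auto simp: card_gt_0_iff)
    have "(\<Sum>T\<in>Pow (- S). (-1) ^ card T) = (0 :: rat) ^ card (- S)"
      using prod_diff_conv_sum[of "- S" "\<lambda>_. 1 :: rat" "\<lambda>_. 1"] by simp
    also have "\<dots> = 0" by (rule zero_power) fact
    finally show ?thesis using False by simp
  qed simp
  finally show ?thesis .
qed

section \<open>Counting lattice points in graded cones\<close>

text \<open>Stars and bars: these functions are the multiplicity functions of multisets of size
  \<open>N\<close> over \<open>B\<close>. The lower index is kept free of \<open>N\<close>, so that
  the count is polynomial in \<open>N\<close>.\<close>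

lemma card_compositions:
  assumes "finite B" "B \<noteq> {}"
  shows "card {a :: 'b \<Rightarrow> nat. (\<forall>w. w \<notin> B \<longrightarrow> a w = 0) \<and> (\<Sum>w\<in>B. a w) = N} = (N + (card B - 1)) choose (card B - 1)"
    (is "card ?L = _")
proof -
  have "bij_betw count (multisets_of_size B N) ?L"
  proof (rule bij_betw_byWitness[of _ Abs_multiset])
    have fin: "finite {w. 0 < a w}" if "\<forall>w. w \<notin> B \<longrightarrow> a w = 0" for a :: "'b \<Rightarrow> nat"
      by (rule finite_subset[OF _ assms(1)]) (use that in force)
    show "\<forall>M\<in>multisets_of_size B N. Abs_multiset (count M) = M" by (simp add: count_inverse)
    show "\<forall>a\<in>?L. count (Abs_multiset a) = a" using fin by (auto simp: count_Abs_multiset)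
    have size: "size M = (\<Sum>w\<in>B. count M w)" if "set_mset M \<subseteq> B" for M
      unfolding size_multiset_overloaded_eq
      by (rule sum.mono_neutral_left) (use assms that in \<open>auto simp: count_eq_zero_iff\<close>)
    show "count ` multisets_of_size B N \<subseteq> ?L"
      by (auto simp: multisets_of_size_def size count_eq_zero_iff)
    show "Abs_multiset ` ?L \<subseteq> multisets_of_size B N"
    proof clarify
      fix a :: "'b \<Rightarrow> nat" assume a: "\<forall>w. w \<notin> B \<longrightarrow> a w = 0" "N = sum a B"
      have cnt: "count (Abs_multiset a) = a" using fin[OF a(1)] by (simp add: count_Abs_multiset)
      then have "set_mset (Abs_multiset a) \<subseteq> B"
        using a(1) by (auto simp: set_mset_def)
      moreover from size[OF this] have "size (Abs_multiset a) = sum a B" unfolding cnt .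
      ultimately show "Abs_multiset a \<in> multisets_of_size B (sum a B)"
        unfolding multisets_of_size_def by blast
    qed
  qed
  then have "card ?L = card (multisets_of_size B N)" by (rule bij_betw_same_card[symmetric])
  also have "\<dots> = (card B + N - 1) choose N" by (rule card_multisets_of_size[OF assms(1)])
  also have "\<dots> = (N + (card B - 1)) choose (card B - 1)"
    using assms by (subst binomial_symmetric) (auto simp: card_gt_0_iff Suc_le_eq add.commute)
  finally show ?thesis .
qed

text \<open>
  The shift by \<open>m j - 1 - s j\<close> is nonnegative, so the binomial coefficient is a polynomial in \<open>n j\<close> that
  is also correct, namely zero, for \<open>n j < s j\<close>.
\<close>

lemma card_class_compositions:
  fixes B :: "'b set" and cls :: "'b \<Rightarrow> 'k::finite" and s n :: "'k \<Rightarrow> nat"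
  defines "m j \<equiv> card {w\<in>B. cls w = j}"
  assumes B: "finite B" and s: "\<And>j. s j < m j"
  shows "card {a :: 'b \<Rightarrow> nat. (\<forall>w. w \<notin> B \<longrightarrow> a w = 0) \<and> (\<forall>j. s j + (\<Sum>w | w \<in> B \<and> cls w = j. a w) = n j)}
     = (\<Prod>j\<in>UNIV. (n j + (m j - 1 - s j)) choose (m j - 1))" (is "card ?L = _")
proof -
  define C where "C j = {w\<in>B. cls w = j}" for j
  define A where "A j = {a :: 'b \<Rightarrow> nat. (\<forall>w. w \<notin> C j \<longrightarrow> a w = 0) \<and> s j + (\<Sum>w\<in>C j. a w) = n j}" for j
  have mC: "m j = card (C j)" for j by (simp add: m_def C_def)
  have C: "finite (C j)" "C j \<noteq> {}" for j
    using B s[of j] by (auto simp: C_def mC simp del: Collect_empty_eq)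
  have "card (A j) = (n j + (m j - 1 - s j)) choose (m j - 1)" for j
  proof (cases "s j \<le> n j")
    case True
    then have "A j = {a. (\<forall>w. w \<notin> C j \<longrightarrow> a w = 0) \<and> (\<Sum>w\<in>C j. a w) = n j - s j}"
      by (auto simp: A_def)
    then have "card (A j) = ((n j - s j) + (m j - 1)) choose (m j - 1)"
      using card_compositions[OF C] by (simp add: m_def C_def)
    also have "(n j - s j) + (m j - 1) = n j + (m j - 1 - s j)"
      using True s[of j] by simp
    finally show ?thesis .
  next
    case False
    then have "A j = {}" by (auto simp: A_def)
    then show ?thesis using False s[of j] by (simp add: binomial_eq_0)
  qed
  \<comment> \<open>Each element has exactly one class, so the conditions for different classes
    decouple and the solutions form a product.\<close>
  moreover have "bij_betw (\<lambda>a j w. if w \<in> C j then a w else 0) ?L (PiE UNIV A)"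
  proof (rule bij_betw_byWitness[of _ "\<lambda>g w. if w \<in> B then g (cls w) w else 0"])
    show "\<forall>a\<in>?L. (\<lambda>w. if w \<in> B then (\<lambda>j w. if w \<in> C j then a w else 0) (cls w) w else 0) = a"
      by (auto simp: C_def fun_eq_iff)
    show "\<forall>g\<in>PiE UNIV A. (\<lambda>j w. if w \<in> C j then (\<lambda>w. if w \<in> B then g (cls w) w else 0) w else 0) = g"
      by (auto simp: C_def A_def fun_eq_iff PiE_iff)
    show "(\<lambda>a j w. if w \<in> C j then a w else 0) ` ?L \<subseteq> PiE UNIV A"
      by (auto simp: A_def C_def PiE_iff)
    show "(\<lambda>g w. if w \<in> B then g (cls w) w else 0) ` PiE UNIV A \<subseteq> ?L"
    proof clarify
      fix g assume g: "g \<in> PiE UNIV A"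
      have "s j + (\<Sum>w | w \<in> B \<and> cls w = j. if w \<in> B then g (cls w) w else 0) = n j" for j
      proof -
        have "(\<Sum>w | w \<in> B \<and> cls w = j. if w \<in> B then g (cls w) w else 0) = (\<Sum>w\<in>C j. g j w)"
          by (intro sum.cong) (auto simp: C_def)
        moreover have "g j \<in> A j" using g by (auto simp: PiE_iff)
        ultimately show ?thesis by (simp add: A_def)
      qed
      then show "(\<forall>w. w \<notin> B \<longrightarrow> (if w \<in> B then g (cls w) w else 0) = 0) \<and>
          (\<forall>j. s j + (\<Sum>w | w \<in> B \<and> cls w = j. if w \<in> B then g (cls w) w else 0) = n j)" by simp
    qed
  qed
  then have "card ?L = card (PiE UNIV A)" by (rule bij_betw_same_card)
  ultimately show ?thesis by (simp add: card_PiE)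
qed

section \<open>Lattice points in half-open simplicial cones\<close>

text \<open>The Cayley cone in abstract form: \<open>H\<close> grades the lattice by integer
  vectors, and a generator \<open>w\<close> has the unit vector at \<open>cls w\<close> as degree.
  Since \<open>cls\<close> is onto, a positive combination of all generators has positive height in
  every direction.\<close>

locale graded_lattice =
  fixes \<Lambda> :: "'a::euclidean_space set" and H :: "'k::finite \<Rightarrow> 'a \<Rightarrow> real"
    and W :: "'a set" and cls :: "'a \<Rightarrow> 'k"
  assumes lattice_add: "x \<in> \<Lambda> \<Longrightarrow> y \<in> \<Lambda> \<Longrightarrow> x + y \<in> \<Lambda>"
    and lattice_diff: "x \<in> \<Lambda> \<Longrightarrow> y \<in> \<Lambda> \<Longrightarrow> x - y \<in> \<Lambda>"
    and lattice_discrete: "bounded S \<Longrightarrow> finite (\<Lambda> \<inter> S)"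
    and H_linear: "linear (H j)"
    and H_lattice: "x \<in> \<Lambda> \<Longrightarrow> H j x \<in> \<int>"
    and finite_W: "finite W"
    and W_lattice: "W \<subseteq> \<Lambda>"
    and H_W: "w \<in> W \<Longrightarrow> H j w = (if cls w = j then 1 else 0)"
    and cls_onto: "cls ` W = UNIV"
begin

definition slice :: "'a set \<Rightarrow> ('k \<Rightarrow> nat) \<Rightarrow> 'a set" where
  "slice S n = {x \<in> \<Lambda> \<inter> S. \<forall>j. H j x = real (n j)}"

lemma lattice_sum:
  assumes "B \<subseteq> W"
  shows "(\<Sum>w\<in>B. real (a w) *\<^sub>R w) \<in> \<Lambda>"
proof -
  have zero: "0 \<in> \<Lambda>"
    using cls_onto W_lattice lattice_diff by (metis diff_self empty_not_UNIV equals0I image_is_empty subsetD)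
  have "real m *\<^sub>R w \<in> \<Lambda>" if "w \<in> W" for m w
    using that W_lattice by (induction m) (auto simp: zero scaleR_left_distrib intro: lattice_add)
  then show ?thesis
    using assms by (induction B rule: infinite_finite_induct) (auto simp: zero intro: lattice_add)
qed

lemma H_sum: "B \<subseteq> W \<Longrightarrow> H j (\<Sum>w\<in>B. c w *\<^sub>R w) = (\<Sum>w | w \<in> B \<and> cls w = j. c w)"
proof -
  assume B: "B \<subseteq> W"
  then have "finite B" using finite_W finite_subset by blast
  have "H j (\<Sum>w\<in>B. c w *\<^sub>R w) = (\<Sum>w\<in>B. c w * H j w)"
    by (simp add: linear_sum[OF H_linear] linear_scale[OF H_linear])
  also have "\<dots> = (\<Sum>w\<in>B. if cls w = j then c w else 0)"
    using B H_W by (intro sum.cong) auto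
  also have "\<dots> = (\<Sum>w | w \<in> B \<and> cls w = j. c w)"
    using \<open>finite B\<close> by (simp add: sum.inter_filter)
  finally show ?thesis .
qed

text \<open>Each lattice point of the cell is uniquely a point \<open>x\<close> of a finite box
  \<open>F\<close> plus a natural combination of \<open>B\<close>. For fixed \<open>x\<close> the
  height condition asks for compositions of \<open>n j - s x j\<close> within each class, which
  \<open>card_class_compositions\<close> counts.\<close>

lemma half_open_cell_count:
  assumes B: "B \<subseteq> W" "independent B" and q: "q \<in> span B" "\<And>j. 0 < H j q"
  shows "finite (slice (half_open_cone q B) n)" (is ?fin)
    and "polyfun (\<lambda>n. of_nat (card (slice (half_open_cone q B) n)))" (is ?poly)
proof -
  let ?r = "representation B"
  have finB: "finite B" using B(1) finite_W finite_subset by blast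
  have expand: "x = (\<Sum>w\<in>B. ?r x w *\<^sub>R w)" if "x \<in> span B" for x
    using real_vector.sum_representation_eq[OF B(2) that finB] by simp
  have Hr: "H j x = (\<Sum>w | w \<in> B \<and> cls w = j. ?r x w)" if "x \<in> span B" for j x
    by (subst expand[OF that], rule H_sum[OF B(1)])
  \<comment> \<open>The interval excludes 0 exactly where the half-open cone demands a positive
    coordinate. Its translates by natural numbers tile the admissible coordinate values.\<close>
  define U where "U w = (if ?r q w < 0 then {0<..1} else {0..<1::real})" for w
  define F where "F = {x \<in> \<Lambda> \<inter> span B. \<forall>w\<in>B. ?r x w \<in> U w}"
  have U01: "0 \<le> t" "t \<le> 1" if "t \<in> U w" for t w using that by (auto simp: U_def split: if_splits)
  have "finite F"
  proof -
    have "norm x \<le> (\<Sum>w\<in>B. norm w)" if x: "x \<in> F" for x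
    proof -
      have "norm x = norm (\<Sum>w\<in>B. ?r x w *\<^sub>R w)" using expand x by (auto simp: F_def)
      also have "\<dots> \<le> (\<Sum>w\<in>B. norm (?r x w *\<^sub>R w))" by (rule norm_sum)
      also have "\<dots> \<le> (\<Sum>w\<in>B. norm w)"
      proof (rule sum_mono)
        fix w assume "w \<in> B"
        then have "\<bar>?r x w\<bar> \<le> 1" using U01[of "?r x w" w] x by (auto simp: F_def)
        then show "norm (?r x w *\<^sub>R w) \<le> norm w" by (simp add: mult_left_le_one_le)
      qed
      finally show ?thesis .
    qed
    then have "finite (\<Lambda> \<inter> F)" by (intro lattice_discrete boundedI)
    moreover have "\<Lambda> \<inter> F = F" by (auto simp: F_def)
    ultimately show ?thesis by simp
  qed
  define m where "m j = card {w\<in>B. cls w = j}" for j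
  \<comment> \<open>On \<open>F\<close> the heights are nonnegative integers, so floor and
    \<open>nat\<close> merely change the type.\<close>
  define s where "s x j = nat \<lfloor>H j x\<rfloor>" for x j
  have s: "real (s x j) = H j x" "s x j < m j" if x: "x \<in> F" for x j
  proof -
    have xs: "x \<in> span B" and xU: "\<And>w. w \<in> B \<Longrightarrow> ?r x w \<in> U w" using x by (auto simp: F_def)
    have "0 \<le> H j x" unfolding Hr[OF xs] using xU U01 by (intro sum_nonneg) auto
    moreover have "H j x \<in> \<int>" using x H_lattice by (auto simp: F_def)
    ultimately show sH: "real (s x j) = H j x" by (auto simp: s_def elim!: Ints_cases)
    \<comment> \<open>Since \<open>q\<close> has positive height, in each class some coordinate of \<open>x\<close> ranges over \<open>[0, 1)\<close>.\<close>
    have "\<exists>w\<in>{w\<in>B. cls w = j}. 0 \<le> ?r q w"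
    proof (rule ccontr)
      assume "\<not> ?thesis"
      then have "H j q \<le> 0" unfolding Hr[OF q(1)] by (intro sum_nonpos) (auto simp: not_le less_imp_le)
      with q(2)[of j] show False by simp
    qed
    then have "\<exists>w\<in>{w\<in>B. cls w = j}. ?r x w < 1" using xU by (force simp: U_def)
    then have "(\<Sum>w\<in>{w\<in>B. cls w = j}. ?r x w) < (\<Sum>w\<in>{w\<in>B. cls w = j}. 1)"
      using finB by (intro sum_strict_mono_ex1) (auto intro: U01(2) xU)
    then have "real (s x j) < real (m j)" using sH Hr[OF xs] by (simp add: m_def)
    then show "s x j < m j" by simp
  qed
  define A where "A x n = {a :: 'a \<Rightarrow> nat. (\<forall>w. w \<notin> B \<longrightarrow> a w = 0) \<and>
      (\<forall>j. s x j + (\<Sum>w | w \<in> B \<and> cls w = j. a w) = n j)}" for x n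
  have cardA: "card (A x n) = (\<Prod>j\<in>UNIV. (n j + (m j - 1 - s x j)) choose (m j - 1))" if "x \<in> F" for x n
    unfolding A_def m_def by (rule card_class_compositions[OF finB]) (use s that in \<open>auto simp: m_def\<close>)
  have finA: "finite (A x n)" for x n
  proof (rule finite_subset)
    show "finite {a. \<forall>w. (w \<in> B \<longrightarrow> a w \<in> {..\<Sum>j\<in>UNIV. n j}) \<and> (w \<notin> B \<longrightarrow> a w = 0)}"
      by (rule finite_set_of_finite_funs[OF finB]) simp
    show "A x n \<subseteq> {a. \<forall>w. (w \<in> B \<longrightarrow> a w \<in> {..\<Sum>j\<in>UNIV. n j}) \<and> (w \<notin> B \<longrightarrow> a w = 0)}"
    proof (intro subsetI CollectI allI conjI impI)
      fix a w assume a: "a \<in> A x n"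
      show "a w = 0" if "w \<notin> B" using a that by (simp add: A_def)
      assume w: "w \<in> B"
      have "s x (cls w) + (\<Sum>v | v \<in> B \<and> cls v = cls w. a v) = n (cls w)"
        using a by (simp add: A_def)
      moreover have "a w \<le> (\<Sum>v | v \<in> B \<and> cls v = cls w. a v)"
        using finB w by (intro member_le_sum) auto
      ultimately have "a w \<le> n (cls w)" by linarith
      also have "\<dots> \<le> (\<Sum>j\<in>UNIV. n j)" by (intro member_le_sum) auto
      finally show "a w \<in> {..\<Sum>j\<in>UNIV. n j}" by simp
    qed
  qed
  define \<phi> where "\<phi> = (\<lambda>(x, a :: 'a \<Rightarrow> nat). x + (\<Sum>w\<in>B. real (a w) *\<^sub>R w))"
  have span\<phi>: "(\<Sum>w\<in>B. c w *\<^sub>R w) \<in> span B" for c by (intro span_sum span_scale span_base)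
  have r\<phi>: "?r (x + (\<Sum>w\<in>B. c w *\<^sub>R w)) w = ?r x w + c w" if "x \<in> span B" "w \<in> B" for x c w
    using that span\<phi> B(2) representation_lincomb[OF B(2) finB] by (simp add: representation_add)
  have "bij_betw \<phi> (Sigma F (\<lambda>x. A x n)) (slice (half_open_cone q B) n)" for n
    unfolding bij_betw_def
  proof
    show "inj_on \<phi> (Sigma F (\<lambda>x. A x n))"
    proof (rule inj_onI, clarify)
      fix x a y b assume x: "x \<in> F" "a \<in> A x n" and y: "y \<in> F" "b \<in> A y n" and eq: "\<phi> (x, a) = \<phi> (y, b)"
      have "a w = b w" for w
      proof (cases "w \<in> B")
        case True
        have "?r x w + real (a w) = ?r y w + real (b w)"
          using eq r\<phi>[of x w "\<lambda>w. real (a w)"] r\<phi>[of y w "\<lambda>w. real (b w)"] x y True by (simp add: F_def \<phi>_def)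
        moreover have "?r x w \<in> U w" "?r y w \<in> U w" using x y True by (auto simp: F_def)
        \<comment> \<open>Two numbers in the same half-open unit interval differ by less than 1,
          which forces the natural parts to agree.\<close>
        ultimately have "\<bar>real (a w) - real (b w)\<bar> < 1" by (auto simp: U_def split: if_splits)
        then show ?thesis by linarith
      next
        case False
        then show ?thesis using x y by (simp add: A_def)
      qed
      then have "a = b" by blast
      with eq show "x = y \<and> a = b" by (simp add: \<phi>_def)
    qed
    show "\<phi> ` Sigma F (\<lambda>x. A x n) = slice (half_open_cone q B) n"
    proof
      show "\<phi> ` Sigma F (\<lambda>x. A x n) \<subseteq> slice (half_open_cone q B) n"
      proof clarify
        fix x a assume x: "x \<in> F" "a \<in> A x n"
        have xs: "x \<in> span B" "x \<in> \<Lambda>" using x(1) by (auto simp: F_def)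
        have "H j (\<phi> (x, a)) = real (s x j + (\<Sum>w | w \<in> B \<and> cls w = j. a w))" for j
          by (simp add: \<phi>_def linear_add[OF H_linear] H_sum[OF B(1)] s(1)[OF x(1)])
        then have "H j (\<phi> (x, a)) = real (n j)" for j
          using x(2) by (simp only: A_def mem_Collect_eq)
        moreover have "\<phi> (x, a) \<in> \<Lambda>"
          using lattice_add[OF xs(2) lattice_sum[OF B(1)]] by (simp add: \<phi>_def)
        moreover have "\<phi> (x, a) \<in> span B" using span_add[OF xs(1) span\<phi>] by (simp add: \<phi>_def)
        moreover have "0 \<le> ?r (\<phi> (x, a)) w \<and> (?r q w < 0 \<longrightarrow> 0 < ?r (\<phi> (x, a)) w)" if "w \<in> B" for w
        proof -
          have "?r x w \<in> U w" using x(1) that by (simp add: F_def)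
          then show ?thesis
            using r\<phi>[OF xs(1) that, of "\<lambda>w. real (a w)"] by (auto simp: \<phi>_def U_def split: if_splits)
        qed
        ultimately show "\<phi> (x, a) \<in> slice (half_open_cone q B) n"
          by (simp add: slice_def half_open_cone_def)
      qed
      show "slice (half_open_cone q B) n \<subseteq> \<phi> ` Sigma F (\<lambda>x. A x n)"
      proof
        fix y assume y: "y \<in> slice (half_open_cone q B) n"
        then have yB: "y \<in> span B" "y \<in> \<Lambda>" and Hy: "\<And>j. H j y = real (n j)"
          and y0: "\<And>w. w \<in> B \<Longrightarrow> 0 \<le> ?r y w" and y1: "\<And>w. w \<in> B \<Longrightarrow> ?r q w < 0 \<Longrightarrow> 0 < ?r y w"
          by (auto simp: slice_def half_open_cone_def)
        \<comment> \<open>Subtracting the floor leaves a remainder in \<open>{0..<1}\<close>,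
          subtracting the ceiling minus 1 leaves one in \<open>{0<..1}\<close>. The sign conditions
          on \<open>y\<close> make both numbers nonnegative before \<open>nat\<close>.\<close>
        define a where "a w = (if w \<notin> B then 0 else if ?r q w < 0 then nat (\<lceil>?r y w\<rceil> - 1) else nat \<lfloor>?r y w\<rfloor>)" for w
        define x where "x = y - (\<Sum>w\<in>B. real (a w) *\<^sub>R w)"
        have y_eq: "y = x + (\<Sum>w\<in>B. real (a w) *\<^sub>R w)" by (simp add: x_def)
        have xs: "x \<in> span B" unfolding x_def by (rule span_diff[OF yB(1) span\<phi>])
        have x\<Lambda>: "x \<in> \<Lambda>" unfolding x_def by (rule lattice_diff[OF yB(2) lattice_sum[OF B(1)]])
        have "?r x w \<in> U w" if w: "w \<in> B" for w
        proof -
          have rx: "?r x w = ?r y w - real (a w)"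
            using r\<phi>[OF xs w, of "\<lambda>w. real (a w)"] y_eq by simp
          show ?thesis
          proof (cases "?r q w < 0")
            case True
            then have "real (a w) = of_int (\<lceil>?r y w\<rceil> - 1)" using y1[OF w] w by (simp add: a_def)
            then show ?thesis using True rx by (simp add: U_def) linarith
          next
            case False
            then have "real (a w) = of_int \<lfloor>?r y w\<rfloor>" using y0[OF w] w by (simp add: a_def)
            then show ?thesis using False rx by (simp add: U_def) linarith
          qed
        qed
        then have xF: "x \<in> F" using xs x\<Lambda> by (simp add: F_def)
        have "real (s x j + (\<Sum>w | w \<in> B \<and> cls w = j. a w)) = real (n j)" for j
          using Hy[of j] unfolding y_eq by (simp add: linear_add[OF H_linear] H_sum[OF B(1)] s(1)[OF xF])
        then have "s x j + (\<Sum>w | w \<in> B \<and> cls w = j. a w) = n j" for j by (metis of_nat_eq_iff)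
        then have "a \<in> A x n" by (simp add: A_def a_def)
        with xF show "y \<in> \<phi> ` Sigma F (\<lambda>x. A x n)" using y_eq by (force simp: \<phi>_def)
      qed
    qed
  qed
  note bij = this
  have "finite (Sigma F (\<lambda>x. A x n))" for n using \<open>finite F\<close> finA by blast
  then show ?fin using bij bij_betw_finite by blast
  have "card (slice (half_open_cone q B) n) = (\<Sum>x\<in>F. card (A x n))" for n
    using bij_betw_same_card[OF bij] \<open>finite F\<close> finA by (metis card_SigmaI)
  then have "of_nat (card (slice (half_open_cone q B) n))
      = (\<Sum>x\<in>F. \<Prod>j\<in>UNIV. of_nat ((n j + (m j - 1 - s x j)) choose (m j - 1)) :: rat)" for n
    using cardA by simp
  then show ?poly
    by (simp only:) (intro polyfun_sum polyfun_prod polyfun_binomial)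
qed

lemma polyfun_slice_cone:
  "polyfun (\<lambda>n. of_nat (card (slice (convex_cone hull W) n)))"
proof (rule half_open_decomposition[OF finite_W])
  fix a \<Delta>
  assume a: "\<And>w. 0 < a w"
    and \<Delta>: "\<And>\<sigma>. \<sigma> \<in> \<Delta> \<Longrightarrow> \<sigma> \<subseteq> W \<and> independent \<sigma> \<and> span \<sigma> = span W"
    and disj: "disjoint_family_on (half_open_cone (\<Sum>w\<in>W. a w *\<^sub>R w)) \<Delta>"
    and Un: "(\<Union>\<sigma>\<in>\<Delta>. half_open_cone (\<Sum>w\<in>W. a w *\<^sub>R w) \<sigma>) = convex_cone hull W"
  define q where "q = (\<Sum>w\<in>W. a w *\<^sub>R w)"
  have "q \<in> span W" unfolding q_def by (intro span_sum span_scale span_base)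
  moreover have "0 < H j q" for j
  proof -
    obtain w where "w \<in> W" "cls w = j" using cls_onto by (metis UNIV_I imageE)
    then show ?thesis
      unfolding q_def H_sum[OF order_refl] using finite_W a by (intro sum_pos) auto
  qed
  ultimately have cell: "finite (slice (half_open_cone q \<sigma>) n)"
      "polyfun (\<lambda>n. of_nat (card (slice (half_open_cone q \<sigma>) n)))" if "\<sigma> \<in> \<Delta>" for \<sigma> n
    using half_open_cell_count[of \<sigma> q] \<Delta>[OF that] by auto
  have "\<Delta> \<subseteq> Pow W" using \<Delta> by blast
  then have fin: "finite \<Delta>" using finite_W finite_subset by blast
  have "of_nat (card (slice (convex_cone hull W) n))
      = (\<Sum>\<sigma>\<in>\<Delta>. of_nat (card (slice (half_open_cone q \<sigma>) n)) :: rat)" for n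
  proof -
    have "slice (convex_cone hull W) n = (\<Union>\<sigma>\<in>\<Delta>. slice (half_open_cone q \<sigma>) n)"
      unfolding Un[symmetric] q_def slice_def by blast
    then show ?thesis
      using disj fin cell(1)
      by (simp add: card_UN_disjoint disjoint_family_on_def q_def slice_def disjoint_iff)
  qed
  then show ?thesis by (simp only:) (intro polyfun_sum cell(2))
qed

end

section \<open>Ehrhart polynomials\<close>

lemma finite_bounded_integer_vectors:
  assumes "bounded S"
  shows "finite {x \<in> S. \<forall>i. (x :: real ^ 'n) $ i \<in> \<int>}"
proof -
  obtain r where r: "\<And>x. x \<in> S \<Longrightarrow> norm x \<le> r" using assms bounded_iff by blast
  have "finite (vec_lambda ` (PiE (UNIV :: 'n set) (\<lambda>_. {t \<in> \<int>. - r \<le> t \<and> t \<le> r})))"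
    by (intro finite_imageI finite_PiE) (auto simp: finite_int_segment)
  moreover have "{x \<in> S. \<forall>i. x $ i \<in> \<int>} \<subseteq> vec_lambda ` (PiE (UNIV :: 'n set) (\<lambda>_. {t \<in> \<int>. - r \<le> t \<and> t \<le> r}))"
  proof
    fix x assume x: "x \<in> {x \<in> S. \<forall>i. x $ i \<in> \<int>}"
    then have "\<bar>x $ i\<bar> \<le> r" for i using r[of x] component_le_norm_cart[of x i] by auto
    then have "vec_nth x \<in> PiE UNIV (\<lambda>_. {t \<in> \<int>. - r \<le> t \<and> t \<le> r})"
      using x by (auto simp: PiE_iff abs_le_iff minus_le_iff)
    then show "x \<in> vec_lambda ` (PiE (UNIV :: 'n set) (\<lambda>_. {t \<in> \<int>. - r \<le> t \<and> t \<le> r}))"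
      by (intro image_eqI[of _ _ "vec_nth x"]) (simp_all add: vec_nth_inverse)
  qed
  ultimately show ?thesis by (rule finite_subset[rotated])
qed

section \<open>The Cayley cone of a family of polytopes\<close>

text \<open>Lifting \<open>V j\<close> to the height of the \<open>j\<close>-th unit vector makes
  weighted Minkowski sums appear as slices of a single cone.\<close>

definition cayley :: "('k::finite \<Rightarrow> (real ^ 'd) set) \<Rightarrow> ((real ^ 'k) \<times> (real ^ 'd)) set" where
  "cayley V = (\<Union>j. Pair (axis j 1) ` V j)"

lemma cayley_cone_iff:
  fixes V :: "'k::finite \<Rightarrow> (real ^ 'd) set" and n :: "'k \<Rightarrow> nat"
  assumes V: "\<And>j. V j \<noteq> {}" and P: "\<And>j. P j = convex hull V j"
  shows "((\<chi> j. real (n j)), x) \<in> convex_cone hull (cayley V) \<longleftrightarrow> x \<in> (\<Sum>j\<in>UNIV. dilate (n j) (P j))"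
proof
  \<comment> \<open>\<open>K\<close> is an explicit convex cone containing the configuration, and
    its points over \<open>n\<close> visibly lie in the Minkowski sum.\<close>
  define K where "K = {(p :: real ^ 'k, x) | p x y. (\<forall>j. 0 \<le> p $ j \<and> y j \<in> P j) \<and> x = (\<Sum>j\<in>UNIV. p $ j *\<^sub>R y j)}"
  have PV: "V j \<subseteq> P j" and conv: "convex (P j)" for j unfolding P by (auto intro: hull_inc)
  have "\<forall>j. \<exists>y. y \<in> P j" using V PV by blast
  then obtain y0 where y0: "\<And>j. y0 j \<in> P j" by metis
  have "convex_cone hull (cayley V) \<subseteq> K"
  proof (rule hull_minimal)
    show "cayley V \<subseteq> K"
    proof (clarsimp simp: cayley_def)
      fix j v assume "v \<in> V j"
      \<comment> \<open>The points \<open>y0\<close> fill the positions of weight 0, where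
        \<open>K\<close> still asks for a point of the polytope.\<close>
      moreover have "v = (\<Sum>i\<in>UNIV. axis j 1 $ i *\<^sub>R (y0(j := v)) i)"
        by (simp add: axis_def if_distrib[of "\<lambda>t. t *\<^sub>R _"] cong: if_cong)
      ultimately show "(axis j 1, v) \<in> K"
        unfolding K_def using y0 PV
        by (intro CollectI exI[of _ "axis j 1"] exI[of _ v] exI[of _ "y0(j := v)"]) (auto simp: axis_def)
    qed
    show "convex_cone K"
      unfolding convex_cone_iff
    proof (intro conjI ballI allI impI)
      show "0 \<in> K"
        unfolding K_def using y0 by (intro CollectI exI[of _ 0] exI[of _ y0]) (auto simp: zero_prod_def)
    next
      fix a b assume "a \<in> K" "b \<in> K"
      then obtain p y q z where a: "a = (p, \<Sum>j\<in>UNIV. p $ j *\<^sub>R y j)" "\<And>j. 0 \<le> p $ j" "\<And>j. y j \<in> P j"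
        and b: "b = (q, \<Sum>j\<in>UNIV. q $ j *\<^sub>R z j)" "\<And>j. 0 \<le> q $ j" "\<And>j. z j \<in> P j"
        unfolding K_def by blast
      \<comment> \<open>Two weighted points of \<open>P j\<close> merge into their weighted mean; if
        both weights are 0, any point of \<open>P j\<close> serves.\<close>
      have "\<exists>u. u \<in> P j \<and> p $ j *\<^sub>R y j + q $ j *\<^sub>R z j = (p $ j + q $ j) *\<^sub>R u" for j
      proof (cases "p $ j + q $ j = 0")
        case True
        then have "p $ j = 0" "q $ j = 0" using a(2)[of j] b(2)[of j] by linarith+
        then show ?thesis using y0 by auto
      next
        case False
        let ?s = "p $ j + q $ j"
        let ?u = "(p $ j / ?s) *\<^sub>R y j + (q $ j / ?s) *\<^sub>R z j"
        have "?u \<in> P j"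
          using a(2,3)[of j] b(2,3)[of j] False
          by (intro convexD[OF conv]) (auto simp: add_divide_distrib[symmetric])
        moreover have "p $ j *\<^sub>R y j + q $ j *\<^sub>R z j = ?s *\<^sub>R ?u"
          using False by (simp add: scaleR_right_distrib)
        ultimately show ?thesis by blast
      qed
      then obtain u where u: "\<And>j. u j \<in> P j"
        "\<And>j. p $ j *\<^sub>R y j + q $ j *\<^sub>R z j = (p $ j + q $ j) *\<^sub>R u j" by metis
      then show "a + b \<in> K"
        unfolding K_def using a b
        by (intro CollectI exI[of _ "p + q"] exI[of _ "\<Sum>j\<in>UNIV. (p + q) $ j *\<^sub>R u j"] exI[of _ u])
          (auto simp: sum.distrib[symmetric])
    next
      fix a and t :: real assume "a \<in> K" "0 \<le> t"
      then obtain p y where a: "a = (p, \<Sum>j\<in>UNIV. p $ j *\<^sub>R y j)" "\<And>j. 0 \<le> p $ j" "\<And>j. y j \<in> P j"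
        unfolding K_def by blast
      then show "t *\<^sub>R a \<in> K"
        unfolding K_def using \<open>0 \<le> t\<close>
        by (intro CollectI exI[of _ "t *\<^sub>R p"] exI[of _ "\<Sum>j\<in>UNIV. (t *\<^sub>R p) $ j *\<^sub>R y j"] exI[of _ y])
          (auto simp: scaleR_sum_right)
    qed
  qed
  moreover assume "((\<chi> j. real (n j)), x) \<in> convex_cone hull (cayley V)"
  ultimately have "((\<chi> j. real (n j)), x) \<in> K" by blast
  then obtain y where "\<And>j. y j \<in> P j" "x = (\<Sum>j\<in>UNIV. real (n j) *\<^sub>R y j)"
    unfolding K_def by auto
  then show "x \<in> (\<Sum>j\<in>UNIV. dilate (n j) (P j))"
    by (auto simp: set_sum_alt dilate_def)
next
  assume "x \<in> (\<Sum>j\<in>UNIV. dilate (n j) (P j))"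
  then obtain z where z: "x = (\<Sum>j\<in>UNIV. z j)" "\<And>j. z j \<in> dilate (n j) (P j)"
    by (auto simp: set_sum_alt)
  then have "\<forall>j. \<exists>y. y \<in> P j \<and> z j = real (n j) *\<^sub>R y" by (auto simp: dilate_def)
  then obtain y where y: "\<And>j. y j \<in> P j" "\<And>j. z j = real (n j) *\<^sub>R y j" by metis
  \<comment> \<open>A singleton times a convex hull is the hull of the product, so the lifted point
    is a convex combination of lifted vertices.\<close>
  have "(axis j 1, y j) \<in> convex_cone hull (cayley V)" for j
  proof -
    have "(axis j 1, y j) \<in> Pair (axis j 1) ` (convex hull V j)" using y(1) P by blast
    also have "\<dots> = {axis j 1} \<times> (convex hull V j)" by auto
    also have "\<dots> = convex hull ({axis j 1} \<times> V j)" by (simp add: convex_hull_Times)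
    also have "\<dots> \<subseteq> convex hull (cayley V)" by (intro hull_mono) (auto simp: cayley_def)
    also have "\<dots> \<subseteq> convex_cone hull (cayley V)" by (rule convex_hull_subset_convex_cone_hull)
    finally show ?thesis .
  qed
  then have mem: "(\<Sum>j\<in>J. real (n j) *\<^sub>R (axis j 1, y j)) \<in> convex_cone hull (cayley V)" for J
    by (induction J rule: infinite_finite_induct)
      (auto intro!: convex_cone_hull_contains_0 convex_cone_hull_add convex_cone_hull_mul simp del: scaleR_Pair)
  have eq: "(\<Sum>j\<in>UNIV. real (n j) *\<^sub>R (axis j 1, y j)) = ((\<chi> j. real (n j)), x)"
  proof (rule prod_eqI)
    show "snd (\<Sum>j\<in>UNIV. real (n j) *\<^sub>R (axis j 1, y j)) = snd ((\<chi> j. real (n j)), x)"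
      by (simp add: snd_sum z y)
    show "fst (\<Sum>j\<in>UNIV. real (n j) *\<^sub>R (axis j 1 :: real ^ 'k, y j)) = fst ((\<chi> j. real (n j)), x)"
      by (simp add: fst_sum vec_eq_iff axis_def if_distrib[of "(*) _"] cong: if_cong)
  qed
  show "((\<chi> j. real (n j)), x) \<in> convex_cone hull (cayley V)"
    using mem[of UNIV] unfolding eq .
qed

text \<open>The integer lattice of the product space is graded by its first block. By the Cayley
  correspondence, \<open>snd\<close> maps the slice at \<open>n\<close> bijectively onto the lattice
  points to be counted.\<close>

lemma bernstein_mcmullen:
  fixes P :: "'k::finite \<Rightarrow> (real ^ 'd) set"
  assumes "\<And>j. lattice_polytope (P j)"
  shows "polyfun (\<lambda>n. of_nat (card ((\<Sum>j\<in>UNIV. dilate (n j) (P j)) \<inter> integer_points)))"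
proof -
  obtain V where V: "\<And>j. finite (V j)" "\<And>j. V j \<noteq> {}" "\<And>j. V j \<subseteq> integer_points"
    and P: "\<And>j. P j = convex hull V j"
    using assms unfolding lattice_polytope_def by metis
  define \<Lambda> where "\<Lambda> = {(p :: real ^ 'k, x :: real ^ 'd). (\<forall>j. p $ j \<in> \<int>) \<and> x \<in> integer_points}"
  have \<Lambda>_iff: "(p, x) \<in> \<Lambda> \<longleftrightarrow> (\<forall>j. p $ j \<in> \<int>) \<and> x \<in> integer_points" for p x
    by (simp add: \<Lambda>_def)
  define H where "H j z = fst z $ j" for j :: 'k and z :: "(real ^ 'k) \<times> (real ^ 'd)"
  \<comment> \<open>The class is read off the first component; distinct indices have distinct unit
    vectors, so the description is unique on the configuration.\<close>
  define cls where "cls z = (THE j. fst z = axis j 1)" for z :: "(real ^ 'k) \<times> (real ^ 'd)"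
  have cls: "cls (axis j 1, v) = j" for j v by (simp add: cls_def axis_eq_axis)
  have axis: "axis j (1 :: real) $ i = (if j = i then 1 else 0)" for i j :: 'k
    by (simp add: axis_def)
  have V_int: "v $ i \<in> \<int>" if "v \<in> V j" for v i j
    using V(3) that by (auto simp: integer_points_def)
  interpret graded_lattice \<Lambda> H "cayley V" cls
  proof unfold_locales
    show "finite (\<Lambda> \<inter> S)" if "bounded S" for S
    proof (rule finite_subset)
      show "\<Lambda> \<inter> S \<subseteq> {p \<in> fst ` S. \<forall>i. p $ i \<in> \<int>} \<times> {x \<in> snd ` S. \<forall>i. x $ i \<in> \<int>}"
        by (force simp: \<Lambda>_def integer_points_def)
      show "finite ({p \<in> fst ` S. \<forall>i. p $ i \<in> \<int>} \<times> {x \<in> snd ` S. \<forall>i. x $ i \<in> \<int>})"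
        by (intro finite_cartesian_product finite_bounded_integer_vectors bounded_fst bounded_snd that)
    qed
    show "cls ` cayley V = UNIV"
    proof (intro equalityI subset_UNIV subsetI)
      fix j
      obtain v where "v \<in> V j" using V(2) by blast
      then show "j \<in> cls ` cayley V"
        by (intro image_eqI[of _ _ "(axis j 1, v)"]) (auto simp: cls cayley_def)
    qed
  qed (use V(1) V_int in \<open>auto simp: \<Lambda>_def H_def integer_points_def cayley_def cls axis\<close>)
  have "card (slice (convex_cone hull cayley V) n) = card ((\<Sum>j\<in>UNIV. dilate (n j) (P j)) \<inter> integer_points)" for n
  proof (rule bij_betw_same_card[of snd], rule bij_betw_byWitness[of _ "\<lambda>x. ((\<chi> j. real (n j)), x)"])
    have eq: "((\<chi> j. real (n j)), snd z) = z" if "z \<in> slice (convex_cone hull cayley V) n" for z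
      using that by (auto simp: slice_def H_def vec_eq_iff prod_eq_iff)
    then show "\<forall>z\<in>slice (convex_cone hull cayley V) n. ((\<chi> j. real (n j)), snd z) = z" by blast
    show "snd ` slice (convex_cone hull cayley V) n \<subseteq> (\<Sum>j\<in>UNIV. dilate (n j) (P j)) \<inter> integer_points"
    proof clarify
      fix p x assume px: "(p, x) \<in> slice (convex_cone hull cayley V) n"
      then have "((\<chi> j. real (n j)), x) \<in> slice (convex_cone hull cayley V) n" using eq[OF px] by simp
      then show "snd (p, x) \<in> (\<Sum>j\<in>UNIV. dilate (n j) (P j)) \<inter> integer_points"
        using cayley_cone_iff[of V P n, OF V(2) P] by (simp add: slice_def \<Lambda>_iff)
    qed
    show "(\<lambda>x. ((\<chi> j. real (n j)), x)) ` ((\<Sum>j\<in>UNIV. dilate (n j) (P j)) \<inter> integer_points)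
        \<subseteq> slice (convex_cone hull cayley V) n"
      using cayley_cone_iff[of V P n, OF V(2) P] by (auto simp: slice_def \<Lambda>_iff H_def)
  qed simp
  then show ?thesis using polyfun_slice_cone by simp
qed

section \<open>From the multivariate to the mixed Ehrhart polynomial\<close>

text \<open>Justifies the definite description: existence is \<open>bernstein_mcmullen\<close>,
  uniqueness is \<open>multi_eval_inject\<close>.\<close>

lemma multi_eval_multi_ehrhart_poly:
  fixes P :: "'k::finite \<Rightarrow> (real ^ 'd) set"
  assumes "\<And>j. lattice_polytope (P j)"
  shows "multi_eval (multi_ehrhart_poly P) (\<lambda>j. of_nat (n j))
    = of_nat (card ((\<Sum>j\<in>UNIV. dilate (n j) (P j)) \<inter> integer_points))"
proof -
  obtain p where p: "\<forall>n. multi_eval p (\<lambda>j. of_nat (n j))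
      = of_nat (card ((\<Sum>j\<in>UNIV. dilate (n j) (P j)) \<inter> integer_points))"
    using bernstein_mcmullen[of P, OF assms] unfolding polyfun_def by blast
  then have "\<forall>n. multi_eval (multi_ehrhart_poly P) (\<lambda>j. of_nat (n j))
      = of_nat (card ((\<Sum>j\<in>UNIV. dilate (n j) (P j)) \<inter> integer_points))"
    unfolding multi_ehrhart_poly_def
    by (rule theI) (rule multi_eval_inject, simp add: p)
  then show ?thesis by blast
qed

lemma dilate_sum:
  fixes P :: "'k \<Rightarrow> (real ^ 'd) set"
  assumes "finite J"
  shows "dilate n (\<Sum>j\<in>J. P j) = (\<Sum>j\<in>J. dilate n (P j))"
proof -
  have plus: "dilate n (A + B) = dilate n A + dilate n B" for A B :: "(real ^ 'd) set"
    by (force simp: dilate_def set_plus_def scaleR_right_distrib)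
  have zero: "dilate n 0 = (0 :: (real ^ 'd) set)" by (simp add: dilate_def set_zero)
  show ?thesis
    using assms by (induction J rule: finite_induct) (simp_all only: sum.empty sum.insert plus zero not_False_eq_True)
qed

lemma ehrhart_poly_sum:
  fixes P :: "'k::finite \<Rightarrow> (real ^ 'd) set"
  assumes P: "\<And>j. lattice_polytope (P j)"
  defines "E \<equiv> multi_ehrhart_poly P"
  shows "ehrhart_poly (\<Sum>j\<in>J. P j) = (\<Sum>\<alpha> | \<alpha> \<in> Poly_Mapping.keys E \<and> {j. \<alpha> j \<noteq> 0} \<subseteq> J.
    monom (Poly_Mapping.lookup E \<alpha>) (\<Sum>j\<in>UNIV. \<alpha> j))" (is "_ = ?p")
proof -
  have "poly ?p (of_nat n) = of_nat (card (dilate n (\<Sum>j\<in>J. P j) \<inter> integer_points))" for n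
  proof -
    define \<nu> where "\<nu> j = (if j \<in> J then n else 0)" for j
    \<comment> \<open>Nonemptiness matters here: the summands outside \<open>J\<close> collapse to
      \<open>{0}\<close>, the neutral element, and not to the empty set.\<close>
    have "dilate 0 (P j) = 0" for j
    proof -
      have "P j \<noteq> {}" using P[of j] unfolding lattice_polytope_def by (metis convex_hull_eq_empty)
      then show ?thesis by (auto simp: dilate_def)
    qed
    then have "(\<Sum>j\<in>UNIV. dilate (\<nu> j) (P j)) = (\<Sum>j\<in>J. dilate n (P j))"
      by (intro sum.mono_neutral_cong_right) (auto simp: \<nu>_def)
    then have "of_nat (card (dilate n (\<Sum>j\<in>J. P j) \<inter> integer_points)) = multi_eval E (\<lambda>j. of_nat (\<nu> j))"
      unfolding E_def by (simp add: multi_eval_multi_ehrhart_poly[OF P] dilate_sum)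
    also have "\<dots> = (\<Sum>\<alpha>\<in>Poly_Mapping.keys E. if {j. \<alpha> j \<noteq> 0} \<subseteq> J
        then Poly_Mapping.lookup E \<alpha> * of_nat n ^ (\<Sum>j\<in>UNIV. \<alpha> j) else 0)"
      unfolding multi_eval_def
    proof (rule sum.cong)
      fix \<alpha> :: "'k \<Rightarrow> nat"
      \<comment> \<open>A positive exponent outside \<open>J\<close> makes the product 0; otherwise
        each factor outside \<open>J\<close> is \<open>0 ^ 0 = 1\<close>.\<close>
      have "(\<Prod>j\<in>UNIV. of_nat (\<nu> j) ^ \<alpha> j) = (if {j. \<alpha> j \<noteq> 0} \<subseteq> J then of_nat n ^ (\<Sum>j\<in>UNIV. \<alpha> j) else 0 :: rat)"
      proof (cases "{j. \<alpha> j \<noteq> 0} \<subseteq> J")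
        case True
        have "of_nat (\<nu> j) ^ \<alpha> j = (of_nat n ^ \<alpha> j :: rat)" for j
        proof (cases "j \<in> J")
          case False
          then have "\<alpha> j = 0" using True by blast
          then show ?thesis by simp
        qed (simp add: \<nu>_def)
        then show ?thesis using True by (simp add: power_sum)
      next
        case False
        then obtain j where "\<alpha> j \<noteq> 0" "j \<notin> J" by blast
        then have "of_nat (\<nu> j) ^ \<alpha> j = (0 :: rat)" by (simp add: \<nu>_def)
        then show ?thesis using False by (auto intro: prod_zero)
      qed
      then show "Poly_Mapping.lookup E \<alpha> * (\<Prod>j\<in>UNIV. of_nat (\<nu> j) ^ \<alpha> j) = (if {j. \<alpha> j \<noteq> 0} \<subseteq> J
        then Poly_Mapping.lookup E \<alpha> * of_nat n ^ (\<Sum>j\<in>UNIV. \<alpha> j) else 0)" by simp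
    qed simp
    also have "\<dots> = poly ?p (of_nat n)"
      by (simp add: poly_sum poly_monom sum.inter_filter if_distrib[of "\<lambda>p. poly p _"] cong: if_cong)
    finally show ?thesis ..
  qed
  then show ?thesis
    unfolding ehrhart_poly_def by (intro the_equality) (auto intro: poly_eqI_nat)
qed

lemma coeff_mixed_ehrhart_poly:
  fixes P :: "'k::finite \<Rightarrow> (real ^ 'd) set"
  assumes P: "\<And>j. lattice_polytope (P j)"
  shows "poly.coeff (mixed_ehrhart_poly P) i =
    (\<Sum>\<alpha> | (\<forall>j. 1 \<le> \<alpha> j) \<and> (\<Sum>j\<in>UNIV. \<alpha> j) = i. Poly_Mapping.lookup (multi_ehrhart_poly P) \<alpha>)"
proof -
  define E where "E = multi_ehrhart_poly P"
  let ?K = "Poly_Mapping.keys E"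
  define e where "e \<alpha> = (if (\<Sum>j\<in>UNIV. \<alpha> j) = i then Poly_Mapping.lookup E \<alpha> else 0)" for \<alpha>
  let ?sg = "\<lambda>J :: 'k set. (-1) ^ (CARD('k) - card J) :: rat"
  have "poly.coeff (mixed_ehrhart_poly P) i
      = (\<Sum>J\<in>UNIV. ?sg J * (\<Sum>\<alpha> | \<alpha> \<in> ?K \<and> {j. \<alpha> j \<noteq> 0} \<subseteq> J. e \<alpha>))"
    unfolding mixed_ehrhart_poly_def ehrhart_poly_sum[OF P] E_def[symmetric]
    by (simp add: coeff_sum e_def)
  also have "\<dots> = (\<Sum>J\<in>UNIV. \<Sum>\<alpha>\<in>?K. if {j. \<alpha> j \<noteq> 0} \<subseteq> J then ?sg J * e \<alpha> else 0)"
    by (intro sum.cong)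
      (simp_all add: sum_distrib_left sum.inter_filter if_distrib[of "(*) _"] cong: if_cong)
  \<comment> \<open>After the exchange each monomial carries the alternating sum over the supersets
    of its support, which is 1 for full support and 0 otherwise.\<close>
  also have "\<dots> = (\<Sum>\<alpha>\<in>?K. \<Sum>J\<in>UNIV. if {j. \<alpha> j \<noteq> 0} \<subseteq> J then ?sg J * e \<alpha> else 0)"
    by (rule sum.swap)
  also have "\<dots> = (\<Sum>\<alpha>\<in>?K. (\<Sum>J | {j. \<alpha> j \<noteq> 0} \<subseteq> J. ?sg J) * e \<alpha>)"
    by (intro sum.cong) (simp_all add: sum_distrib_right sum.If_cases)
  also have "\<dots> = (\<Sum>\<alpha>\<in>?K. if (\<forall>j. 1 \<le> \<alpha> j) \<and> (\<Sum>j\<in>UNIV. \<alpha> j) = i then Poly_Mapping.lookup E \<alpha> else 0)"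
  proof -
    have "{j. \<alpha> j \<noteq> 0} = UNIV \<longleftrightarrow> (\<forall>j. 1 \<le> \<alpha> j)" for \<alpha> :: "'k \<Rightarrow> nat"
      by (simp add: set_eq_iff Suc_le_eq)
    then show ?thesis
      unfolding alternating_sum_supersets by (intro sum.cong) (simp_all add: e_def)
  qed
  also have "\<dots> = (\<Sum>\<alpha> | \<alpha> \<in> ?K \<and> (\<forall>j. 1 \<le> \<alpha> j) \<and> (\<Sum>j\<in>UNIV. \<alpha> j) = i. Poly_Mapping.lookup E \<alpha>)"
    by (simp add: sum.inter_filter)
  \<comment> \<open>The restriction to the keys is dropped. The larger index set must be finite,
    since sums over infinite sets are 0 by convention; its entries are bounded by
    \<open>i\<close>.\<close>
  also have "\<dots> = (\<Sum>\<alpha> | (\<forall>j. 1 \<le> \<alpha> j) \<and> (\<Sum>j\<in>UNIV. \<alpha> j) = i. Poly_Mapping.lookup E \<alpha>)"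
  proof (rule sum.mono_neutral_left)
    have "\<alpha> j \<le> i" if "(\<Sum>j\<in>UNIV. \<alpha> j) = i" for \<alpha> :: "'k \<Rightarrow> nat" and j
      using member_le_sum[of j UNIV \<alpha>] that by simp
    then have "{\<alpha> :: 'k \<Rightarrow> nat. (\<forall>j. 1 \<le> \<alpha> j) \<and> (\<Sum>j\<in>UNIV. \<alpha> j) = i} \<subseteq> PiE UNIV (\<lambda>_. {..i})"
      by (auto simp: PiE_iff)
    then show "finite {\<alpha> :: 'k \<Rightarrow> nat. (\<forall>j. 1 \<le> \<alpha> j) \<and> (\<Sum>j\<in>UNIV. \<alpha> j) = i}"
      by (rule finite_subset) (auto intro: finite_PiE)
  qed (auto simp: in_keys_iff)
  finally show ?thesis by (simp add: E_def)
qed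

theorem theorem2p4:
  fixes P :: "'k::finite \<Rightarrow> (real ^ 'd) set"
  assumes "\<And>j. lattice_polytope (P j)"
    and "aff_dim (\<Sum>j\<in>UNIV. P j) = int CARD('d)"
  shows "(\<forall>i\<le>CARD('d). poly.coeff (mixed_ehrhart_poly P) i =
            (\<Sum>\<alpha> | (\<forall>j. 1 \<le> \<alpha> j) \<and> (\<Sum>j\<in>UNIV. \<alpha> j) = i.
               Poly_Mapping.lookup (multi_ehrhart_poly P) \<alpha>))
       \<and> (\<forall>i<CARD('k). poly.coeff (mixed_ehrhart_poly P) i = 0)"
proof (intro conjI allI impI)
  fix i assume i: "i < CARD('k)"
  \<comment> \<open>Entries that are all at least 1 add up to at least their number, so for smaller
    \<open>i\<close> the sum is empty.\<close>
  have "CARD('k) \<le> (\<Sum>j\<in>UNIV. \<alpha> j)" if "\<forall>j. 1 \<le> \<alpha> j" for \<alpha> :: "'k \<Rightarrow> nat"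
    using sum_mono[of UNIV "\<lambda>_. 1" \<alpha>] that by simp
  then have "{\<alpha> :: 'k \<Rightarrow> nat. (\<forall>j. 1 \<le> \<alpha> j) \<and> (\<Sum>j\<in>UNIV. \<alpha> j) = i} = {}"
    using i leD by blast
  then show "poly.coeff (mixed_ehrhart_poly P) i = 0"
    unfolding coeff_mixed_ehrhart_poly[OF assms(1)] by (simp only: sum.empty)
qed (rule coeff_mixed_ehrhart_poly[OF assms(1)])

end
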